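(* For orders $\alpha,\beta$, the fractional wave equation $$\frac{\partial^{\beta}}{\partial u^{\beta}}\frac{\partial^{\alpha}}{\partial v^{\alpha}}f=0,$$ equivalently $$\int_{\mathbb{R}}\bigg[\int_{\mathbb{R}}f(z,y)\,\delta^{(\alpha)}(v-y)\,dy\bigg]\delta^{(\beta)}(u-z)\,dz=0,$$ where $u=x+t$ and $v=x-t$, has the fundamental solution $$\frac{1}{2}\delta^{(-\beta)}(u)\,\delta^{(-\alpha)}(v)=\frac{u^{\beta-1}v^{\alpha-1}}{2\,\Gamma(\beta)\Gamma(\alpha)}H(u)H(v)=\frac{(x+t)^{\beta-1}(x-t)^{\alpha-1}}{2\,\Gamma(\beta)\Gamma(\alpha)}H(x+t)H(x-t).$$
   Context: $H$ is the Heaviside step function. For $\alpha\in\mathbb{C}$, $\delta^{(-\alpha)}(x)=\frac{x^{\alpha-1}}{\Gamma(\alpha)}H(x)$ is the fractional integral of order $\alpha$ of the Dirac delta, and $\delta^{(\alpha)}$ its fractional derivative of order $\alpha$. For a test function $\phi\in\mathcal{D}(\mathbb{R})$, the distributional differintegral is $\phi^{(-\alpha)}(x)=\int_{\mathbb{R}}\phi(t)\,\delta^{(-\alpha)}(x-t)\,dt$, and the differintegral of a distribution $T$ is $T^{(-\alpha)}[\phi]=e^{-i\pi\alpha}\,T[\phi^{(-\alpha)}]$ for all test functions $\phi$. The operators satisfy the index law: the differintegral of order $-\alpha$ followed by that of order $-\beta$ is that of order $-\alpha-\beta$. The partial fractional derivatives $\partial^{\beta}/\partial u^{\beta}$ and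 $\partial^{\alpha}/\partial v^{\alpha}$ are these derivatives of orders $\beta$, $\alpha$ in the variables $u$, $v$, i.e. convolution with $\delta^{(\beta)}$ in $u$ and with $\delta^{(\alpha)}$ in $v$. A fundamental solution is a distribution $E$ such that $\frac{\partial^{\beta}}{\partial u^{\beta}}\frac{\partial^{\alpha}}{\partial v^{\alpha}}E=\delta(u,v)$, with the normalization convention $\delta(u,v)=\frac{1}{2}\delta(u)\delta(v)$. (With this convention, for $\alpha=\beta=1$ the fundamental solution is $\frac12 H(u)H(v)=\frac12H(x+t)H(x-t)$.) *)

theory Defs
  imports "HOL-Analysis.Analysis"
begin

section \<open>Test functions and distributions\<close>

definition dirderiv :: "'a::euclidean_space \<Rightarrow> ('a \<Rightarrow> complex) \<Rightarrow> 'a \<Rightarrow> complex" where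
  "dirderiv b f x = frechet_derivative f (at x) b"

primrec Ck :: "nat \<Rightarrow> ('a::euclidean_space \<Rightarrow> complex) \<Rightarrow> bool" where
  "Ck 0 f \<longleftrightarrow> continuous_on UNIV f"
| "Ck (Suc n) f \<longleftrightarrow> f differentiable_on UNIV \<and> (\<forall>b\<in>Basis. Ck n (dirderiv b f))"

definition tsupport :: "('a::euclidean_space \<Rightarrow> complex) \<Rightarrow> 'a set" where
  "tsupport f = closure {x. f x \<noteq> 0}"

definition test_function :: "('a::euclidean_space \<Rightarrow> complex) \<Rightarrow> bool" where
  "test_function f \<longleftrightarrow> (\<forall>n. Ck n f) \<and> compact (tsupport f)"

text \<open>A distribution is represented by a functional on all functions, of which only the values at
  test functions matter.  Continuity is the usual seminorm estimate on each compact set \<open>K\<close>, with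
  \<open>M\<close> ranging over the bounds for all partial derivatives of order at most \<open>N\<close>.\<close>

definition distribution :: "(('a::euclidean_space \<Rightarrow> complex) \<Rightarrow> complex) \<Rightarrow> bool" where
  "distribution T \<longleftrightarrow>
     (\<forall>\<phi> \<psi>. test_function \<phi> \<longrightarrow> test_function \<psi> \<longrightarrow> T (\<lambda>x. \<phi> x + \<psi> x) = T \<phi> + T \<psi>) \<and>
     (\<forall>c \<phi>. test_function \<phi> \<longrightarrow> T (\<lambda>x. c * \<phi> x) = c * T \<phi>) \<and>
     (\<forall>K. compact K \<longrightarrow> (\<exists>C N. \<forall>\<phi> M. test_function \<phi> \<longrightarrow> tsupport \<phi> \<subseteq> K \<longrightarrow>
        (\<forall>bs. set bs \<subseteq> Basis \<longrightarrow> length bs \<le> N \<longrightarrow> (\<forall>x. norm (foldr dirderiv bs \<phi> x) \<le> M)) \<longrightarrow>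
        norm (T \<phi>) \<le> C * M))"

definition regular :: "('a::euclidean_space \<Rightarrow> complex) \<Rightarrow> ('a \<Rightarrow> complex) \<Rightarrow> complex" where
  "regular f \<phi> = (LINT x|lborel. f x * \<phi> x)"

definition dirac :: "(real \<Rightarrow> complex) \<Rightarrow> complex" where
  "dirac \<phi> = \<phi> 0"

definition dist_deriv ::
    "'a::euclidean_space \<Rightarrow> (('a \<Rightarrow> complex) \<Rightarrow> complex) \<Rightarrow> ('a \<Rightarrow> complex) \<Rightarrow> complex" where
  "dist_deriv b T \<phi> = - T (dirderiv b \<phi>)"

definition tensor ::
    "((real \<Rightarrow> complex) \<Rightarrow> complex) \<Rightarrow> ((real \<Rightarrow> complex) \<Rightarrow> complex) \<Rightarrow> (real \<times> real \<Rightarrow> complex) \<Rightarrow> complex"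
  where "tensor S T \<phi> = S (\<lambda>u. T (\<lambda>v. \<phi> (u, v)))"


section \<open>Fractional derivatives of the Dirac delta\<close>

definition heaviside :: "real \<Rightarrow> complex" where
  "heaviside x = (if 0 < x then 1 else 0)"

definition frac_kernel :: "complex \<Rightarrow> real \<Rightarrow> complex" where
  "frac_kernel a x = of_real x powr (a - 1) / Gamma a * heaviside x"

definition frac_index :: "complex \<Rightarrow> nat" where
  "frac_index s = (LEAST n. Re s < real n)"

text \<open>\<open>frac_delta s\<close> is \<open>\<delta>\<^sup>(\<^sup>s\<^sup>)\<close>.  The function \<open>frac_kernel (-s)\<close> is locally integrable only for
  \<open>Re s < 0\<close>; there \<open>frac_index s = 0\<close> and \<open>frac_delta s\<close> is that function.  Otherwise it is the
  Riemann--Liouville derivative, i.e. the \<open>n\<close>-th distributional derivative of the locally integrable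
  function \<open>\<delta>\<^sup>(\<^sup>s\<^sup>-\<^sup>n\<^sup>)\<close>, which is also the analytic continuation in \<open>s\<close>.\<close>

definition frac_delta :: "complex \<Rightarrow> (real \<Rightarrow> complex) \<Rightarrow> complex" where
  "frac_delta s =
     (let n = frac_index s in (dist_deriv 1 ^^ n) (regular (frac_kernel (of_nat n - s))))"


section \<open>Convolution and fractional derivatives of distributions\<close>

text \<open>Since a convolution of two distributions need not exist, convolution and fractional
  derivatives are relations, defined by the usual limit over sequences of cut-off functions
  converging to 1.  On distributions supported in a half-space \<open>x \<bullet> b \<ge> a\<close> the sequences for the
  fractional derivatives are eventually constant.\<close>

definition unit_sequence :: "(nat \<Rightarrow> real \<Rightarrow> complex) \<Rightarrow> bool" where
  "unit_sequence \<eta> \<longleftrightarrow>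
     (\<forall>k. test_function (\<eta> k)) \<and>
     (\<forall>K. compact K \<longrightarrow> (\<forall>\<^sub>F k in sequentially. \<forall>x\<in>K. \<eta> k x = 1)) \<and>
     (\<forall>m. \<exists>C. \<forall>k x. norm ((dirderiv 1 ^^ m) (\<eta> k) x) \<le> C)"

text \<open>\<open>has_convolution b T S R\<close>: the convolution of \<open>T\<close> with the one-dimensional distribution \<open>S\<close> in
  the variable with unit vector \<open>b\<close> exists and equals \<open>R\<close>.\<close>

definition has_convolution ::
    "'a::euclidean_space \<Rightarrow> (('a \<Rightarrow> complex) \<Rightarrow> complex) \<Rightarrow> ((real \<Rightarrow> complex) \<Rightarrow> complex) \<Rightarrow>
     (('a \<Rightarrow> complex) \<Rightarrow> complex) \<Rightarrow> bool" where
  "has_convolution b T S R \<longleftrightarrow> distribution R \<and>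
     (\<forall>\<phi> \<eta>. test_function \<phi> \<longrightarrow> unit_sequence \<eta> \<longrightarrow>
        (\<lambda>k. T (\<lambda>p. \<eta> k (p \<bullet> b) * S (\<lambda>r. \<phi> (p + r *\<^sub>R b)))) \<longlonglongrightarrow> R \<phi>)"

text \<open>The transposed differintegral of a test function in direction \<open>b\<close>.  It plays the role of
  \<open>e\<^sup>-\<^sup>i\<^sup>\<pi>\<^sup>\<alpha> \<phi>\<^sup>(\<^sup>-\<^sup>\<alpha>\<^sup>)\<close> with \<open>\<alpha> = -s\<close>: the phase turns the powers of \<open>x - t\<close> into powers of \<open>t - x\<close>, and
  the kernel is supported in \<open>r = t - x \<ge> 0\<close>, as the transpose of convolution with \<open>\<delta>\<^sup>(\<^sup>s\<^sup>)\<close> requires.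
  For \<open>s = n\<close> a natural number it is \<open>(-1)\<^sup>n\<close> times the \<open>n\<close>-th derivative.\<close>

definition frac_transpose :: "'a::euclidean_space \<Rightarrow> complex \<Rightarrow> ('a \<Rightarrow> complex) \<Rightarrow> 'a \<Rightarrow> complex" where
  "frac_transpose b s \<phi> p =
     (let n = frac_index s in
      (- 1) ^ n * (LINT r|lborel. frac_kernel (of_nat n - s) r * (dirderiv b ^^ n) \<phi> (p + r *\<^sub>R b)))"

text \<open>\<open>has_frac_deriv b s T R\<close>: the fractional derivative of \<open>T\<close> of order \<open>s\<close> in the variable with
  unit vector \<open>b\<close> exists and equals \<open>R\<close>.\<close>

definition has_frac_deriv ::
    "'a::euclidean_space \<Rightarrow> complex \<Rightarrow> (('a \<Rightarrow> complex) \<Rightarrow> complex) \<Rightarrow>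
     (('a \<Rightarrow> complex) \<Rightarrow> complex) \<Rightarrow> bool" where
  "has_frac_deriv b s T R \<longleftrightarrow> distribution R \<and>
     (\<forall>\<phi> \<eta>. test_function \<phi> \<longrightarrow> unit_sequence \<eta> \<longrightarrow>
        (\<lambda>k. T (\<lambda>p. \<eta> k (p \<bullet> b) * frac_transpose b s \<phi> p)) \<longlonglongrightarrow> R \<phi>)"


section \<open>The fractional wave equation\<close>

text \<open>Points of the plane are \<open>(u, v)\<close>.\<close>

definition u_dir :: "real \<times> real" where "u_dir = (1, 0)"

definition v_dir :: "real \<times> real" where "v_dir = (0, 1)"

definition wave_operator ::
    "complex \<Rightarrow> complex \<Rightarrow> ((real \<times> real \<Rightarrow> complex) \<Rightarrow> complex) \<Rightarrow>
     ((real \<times> real \<Rightarrow> complex) \<Rightarrow> complex) \<Rightarrow> bool" where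
  "wave_operator \<alpha> \<beta> f g \<longleftrightarrow> (\<exists>h. has_frac_deriv v_dir \<alpha> f h \<and> has_frac_deriv u_dir \<beta> h g)"

definition wave_equation ::
    "complex \<Rightarrow> complex \<Rightarrow> ((real \<times> real \<Rightarrow> complex) \<Rightarrow> complex) \<Rightarrow> bool" where
  "wave_equation \<alpha> \<beta> f \<longleftrightarrow> wave_operator \<alpha> \<beta> f (\<lambda>_. 0)"

definition wave_integral_equation ::
    "complex \<Rightarrow> complex \<Rightarrow> ((real \<times> real \<Rightarrow> complex) \<Rightarrow> complex) \<Rightarrow> bool" where
  "wave_integral_equation \<alpha> \<beta> f \<longleftrightarrow>
     (\<exists>h. has_convolution v_dir f (frac_delta \<alpha>) h \<and>
          has_convolution u_dir h (frac_delta \<beta>) (\<lambda>_. 0))"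

definition delta_uv :: "(real \<times> real \<Rightarrow> complex) \<Rightarrow> complex" where
  "delta_uv \<phi> = 1 / 2 * tensor dirac dirac \<phi>"

definition fundamental_solution ::
    "complex \<Rightarrow> complex \<Rightarrow> ((real \<times> real \<Rightarrow> complex) \<Rightarrow> complex) \<Rightarrow> bool" where
  "fundamental_solution \<alpha> \<beta> E \<longleftrightarrow> distribution E \<and> wave_operator \<alpha> \<beta> E delta_uv"

text \<open>The distribution \<open>T(x + t, x - t)\<close> on the \<open>(x, t)\<close>-plane; \<open>1/2\<close> is the Jacobian in
  \<open>dx dt = 1/2 du dv\<close>.\<close>

definition in_xt ::
    "((real \<times> real \<Rightarrow> complex) \<Rightarrow> complex) \<Rightarrow> (real \<times> real \<Rightarrow> complex) \<Rightarrow> complex" where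
  "in_xt T \<psi> = 1 / 2 * T (\<lambda>(u, v). \<psi> ((u + v) / 2, (u - v) / 2))"

end

theory Submission
  imports Defs
begin

text \<open>On test functions, \<open>\<delta>\<^sup>(\<^sup>s\<^sup>)\<close> is \<open>(- 1)\<^sup>n\<close> times integration of the \<open>n\<close>-th derivative against the locally
  integrable kernel \<open>k a x = x\<^sup>a\<^sup>-\<^sup>1 / \<Gamma>(a)\<close>, \<open>a = n - s\<close>.  Since \<open>k a\<close> and \<open>k b\<close> convolve to \<open>k (a + b)\<close>,
  applying \<open>\<delta>\<^sup>(\<^sup>-\<^sup>s\<^sup>)\<close> to the transposed derivative of order \<open>s\<close> of \<open>f\<close> leaves the integral of \<open>k N\<close> times the
  \<open>N\<close>-th derivative of \<open>f\<close> for some integer \<open>N > 0\<close>, which is \<open>(- 1)\<^sup>N f(0)\<close>.  This holds in each variable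
  separately, so the derivative in \<open>v\<close> turns \<open>\<delta>\<^sup>(\<^sup>-\<^sup>\<beta>\<^sup>)(u) \<delta>\<^sup>(\<^sup>-\<^sup>\<alpha>\<^sup>)(v)\<close> into \<open>\<delta>\<^sup>(\<^sup>-\<^sup>\<beta>\<^sup>)(u) \<delta>(v)\<close>, and the one in \<open>u\<close> turns
  that into \<open>\<delta>(u) \<delta>(v)\<close>.  The cut-offs play no role: all kernels live on the positive half-line and
  the transposed derivatives of \<open>f\<close> vanish to the right of the support of \<open>f\<close>.\<close>


section \<open>Calculus of test functions\<close>

definition smooth :: "('a::euclidean_space \<Rightarrow> complex) \<Rightarrow> bool" where
  "smooth f \<longleftrightarrow> (\<forall>n. Ck n f)"

lemma smoothD:
  assumes "smooth f"
  shows smooth_differentiable: "f differentiable (at x)"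
    and smooth_continuous: "continuous_on UNIV f"
    and smooth_dirderiv: "b \<in> Basis \<Longrightarrow> smooth (dirderiv b f)"
proof -
  have "Ck (Suc n) f" for n
    using assms by (simp add: smooth_def)
  then show "f differentiable (at x)" "b \<in> Basis \<Longrightarrow> smooth (dirderiv b f)"
    by (auto simp: smooth_def differentiable_on_def)
  show "continuous_on UNIV f"
    using assms unfolding smooth_def by (metis Ck.simps(1))
qed

text \<open>Serves for parameter integrals: each derivative of such an integral has the same shape
  with another integrand, so closure of the class under differentiation replaces a formula for every
  order.\<close>

lemma smooth_coinduct:
  assumes "P f"
    and step: "\<And>f. P f \<Longrightarrow> (\<forall>x. f differentiable (at x)) \<and> (\<forall>b\<in>Basis. P (dirderiv b f))"
  shows "smooth f"
proof -
  have "P f \<Longrightarrow> Ck n f" for n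
  proof (induction n arbitrary: f)
    case 0
    then show ?case
      using step[OF 0] by (auto intro!: differentiable_imp_continuous_on simp: differentiable_on_def)
  next
    case (Suc n)
    then show ?case
      using step[of f] by (auto simp: differentiable_on_def)
  qed
  then show ?thesis
    using assms(1) by (simp add: smooth_def)
qed

section \<open>Directional derivatives, linearity and the chain rule\<close>

lemma dirderiv_eqI: "(f has_derivative f') (at x) \<Longrightarrow> dirderiv b f x = f' b"
  unfolding dirderiv_def using frechet_derivative_at by metis

text \<open>\<open>frechet_derivative\<close> is a choice among all derivatives at the point, so two
  functions with the same \<open>has_derivative\<close> relation there get the same value,
  differentiable or not.\<close>

lemma dirderiv_cong_open:
  assumes "open S" "x \<in> S" "\<And>y. y \<in> S \<Longrightarrow> f y = g y"
  shows "dirderiv b f x = dirderiv b g x"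
proof -
  have "(f has_derivative D) (at x) \<longleftrightarrow> (g has_derivative D) (at x)" for D
    using assms has_derivative_transform_within_open[of f D x UNIV S g]
      has_derivative_transform_within_open[of g D x UNIV S f] by auto
  then show ?thesis
    by (simp add: dirderiv_def frechet_derivative_def)
qed

lemma funpow_dirderiv_cong_open:
  assumes "open S" "\<And>y. y \<in> S \<Longrightarrow> f y = g y" "x \<in> S"
  shows "(dirderiv b ^^ n) f x = (dirderiv b ^^ n) g x"
  using assms(3)
proof (induction n arbitrary: x)
  case (Suc n)
  then show ?case
    using assms(1) by (auto intro!: dirderiv_cong_open[of S])
qed (use assms in auto)

lemma smooth_has_vector_derivative:
  assumes "smooth f"
  shows "((\<lambda>r. f (p + r *\<^sub>R b)) has_vector_derivative dirderiv b f (p + r *\<^sub>R b)) (at r)"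
proof -
  have "(f has_derivative frechet_derivative f (at (p + r *\<^sub>R b))) (at (p + r *\<^sub>R b))"
    using smooth_differentiable[OF assms] by (simp add: frechet_derivative_works)
  then have D: "((\<lambda>r. f (p + r *\<^sub>R b)) has_derivative
      (\<lambda>h. frechet_derivative f (at (p + r *\<^sub>R b)) (h *\<^sub>R b))) (at r)"
    by (rule has_derivative_compose[rotated]) (auto intro!: derivative_eq_intros)
  have "linear (frechet_derivative f (at (p + r *\<^sub>R b)))"
    using smooth_differentiable[OF assms] by (simp add: linear_frechet_derivative)
  then show ?thesis
    using D by (simp add: has_vector_derivative_def dirderiv_def linear_cmul)
qed

lemma dirderiv_1_eqI:
  "(f has_vector_derivative f') (at x) \<Longrightarrow> dirderiv 1 f x = f'"
  by (simp add: dirderiv_eqI[where f' = "\<lambda>h. h *\<^sub>R f'"] has_vector_derivative_def)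

lemma smooth_has_vector_derivative_1:
  fixes f :: "real \<Rightarrow> complex"
  assumes "smooth f"
  shows "(f has_vector_derivative dirderiv 1 f x) (at x)"
  using smooth_has_vector_derivative[OF assms, of 0 1 x] by simp

text \<open>The one combination \<open>f x + c * g x\<close> covers sums and, with \<open>f\<close>
  zero, multiples; the linearity statements below keep this form.\<close>

lemma dirderiv_add_scale:
  assumes "f differentiable (at x)" "g differentiable (at x)"
  shows "dirderiv b (\<lambda>x. f x + c * g x) x = dirderiv b f x + c * dirderiv b g x"
proof -
  have "(f has_derivative frechet_derivative f (at x)) (at x)"
    "(g has_derivative frechet_derivative g (at x)) (at x)"
    using assms by (simp_all add: frechet_derivative_works[symmetric])
  then have "((\<lambda>x. f x + c * g x) has_derivative
      (\<lambda>h. frechet_derivative f (at x) h + c * frechet_derivative g (at x) h)) (at x)"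
    by (auto intro!: derivative_eq_intros)
  then show ?thesis
    by (subst dirderiv_eqI) (auto simp: dirderiv_def)
qed

lemma Ck_add_scale: "Ck n f \<Longrightarrow> Ck n g \<Longrightarrow> Ck n (\<lambda>x. f x + c * g x)"
proof (induction n arbitrary: f g)
  case 0
  then show ?case
    by (auto intro!: continuous_intros)
next
  case (Suc n)
  then have "dirderiv b (\<lambda>x. f x + c * g x) = (\<lambda>x. dirderiv b f x + c * dirderiv b g x)" for b
    by (auto intro!: dirderiv_add_scale simp: differentiable_on_def)
  with Suc show ?case
    by (auto simp: differentiable_on_def intro!: derivative_intros)
qed

lemma Ck_const: "Ck n (\<lambda>_. c)"
proof (induction n arbitrary: c)
  case (Suc n)
  have "dirderiv b (\<lambda>_. c) = (\<lambda>_. 0)" for b :: 'a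
    by (rule ext, subst dirderiv_eqI[where f' = "\<lambda>_. 0"]) auto
  then show ?case
    using Suc by simp
qed simp

lemma Ck_sum: "(\<And>i. i \<in> I \<Longrightarrow> Ck n (f i)) \<Longrightarrow> Ck n (\<lambda>x. \<Sum>i\<in>I. c i * f i x)"
proof (induction I rule: infinite_finite_induct)
  case (insert i I)
  have "Ck n (\<lambda>x. (\<Sum>i\<in>I. c i * f i x) + c i * f i x)"
    using insert by (intro Ck_add_scale) auto
  then show ?case
    using insert by (simp add: add.commute)
qed (auto simp: Ck_const)

text \<open>The chain rule writes a derivative of the composite as a linear combination of partial
  derivatives of \<open>f\<close> composed with the same affine map, so induction on the order goes
  through. Sections along a line and light-cone coordinates are the two uses.\<close>

lemma Ck_affine:
  fixes l :: "'b::euclidean_space \<Rightarrow> 'a::euclidean_space"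
  assumes l: "linear l"
  shows "Ck n f \<Longrightarrow> Ck n (\<lambda>x. f (p + l x))"
proof (induction n arbitrary: f)
  case 0
  have "continuous_on UNIV (\<lambda>x. p + l x)"
    using l by (intro continuous_intros linear_continuous_on linear_conv_bounded_linear[THEN iffD1])
  with 0 show ?case
    using continuous_on_compose2[of UNIV f] by simp
next
  case (Suc n)
  have D: "((\<lambda>x. f (p + l x)) has_derivative (\<lambda>h. frechet_derivative f (at (p + l x)) (l h))) (at x)" for x
  proof -
    have "(f has_derivative frechet_derivative f (at (p + l x))) (at (p + l x))"
      using Suc.prems by (simp add: frechet_derivative_works[symmetric] differentiable_on_def)
    moreover have "((\<lambda>x. p + l x) has_derivative l) (at x)"
      using l by (auto intro!: derivative_eq_intros linear_imp_has_derivative)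
    ultimately show ?thesis
      by (rule has_derivative_compose[rotated])
  qed
  have "dirderiv b (\<lambda>x. f (p + l x)) = (\<lambda>x. \<Sum>c\<in>Basis. of_real (l b \<bullet> c) * dirderiv c f (p + l x))" for b
  proof
    fix x
    have lin: "linear (frechet_derivative f (at (p + l x)))"
      using Suc.prems by (simp add: linear_frechet_derivative differentiable_on_def)
    have "dirderiv b (\<lambda>x. f (p + l x)) x = frechet_derivative f (at (p + l x)) (l b)"
      by (rule dirderiv_eqI[OF D])
    \<comment> \<open>\<open>Ck\<close> controls derivatives along basis vectors only, so the
      direction \<open>l b\<close> is expanded in the basis.\<close>
    also have "\<dots> = frechet_derivative f (at (p + l x)) (\<Sum>c\<in>Basis. (l b \<bullet> c) *\<^sub>R c)"
      by (simp add: euclidean_representation)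
    also have "\<dots> = (\<Sum>c\<in>Basis. of_real (l b \<bullet> c) * dirderiv c f (p + l x))"
      by (simp add: linear_sum[OF lin] linear_cmul[OF lin] dirderiv_def scaleR_conv_of_real)
    finally show "dirderiv b (\<lambda>x. f (p + l x)) x = \<dots>" .
  qed
  moreover have "Ck n (\<lambda>x. dirderiv c f (p + l x))" if "c \<in> Basis" for c
    using Suc that by simp
  ultimately show ?case
    using D by (auto simp: differentiable_on_def differentiable_def intro!: Ck_sum)
qed

lemma smooth_affine: "linear l \<Longrightarrow> smooth f \<Longrightarrow> smooth (\<lambda>x. f (p + l x))"
  by (simp add: smooth_def Ck_affine)

lemma smooth_add_scale: "smooth f \<Longrightarrow> smooth g \<Longrightarrow> smooth (\<lambda>x. f x + c * g x)"
  by (simp add: smooth_def Ck_add_scale)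

section \<open>Test functions, their derivatives and their sections\<close>

text \<open>Vanishing outside a ball passes to derivatives, sections and linear combinations more
  directly than compactness of a closure does.\<close>

lemma test_function_iff:
  "test_function f \<longleftrightarrow> smooth f \<and> (\<exists>R. \<forall>x. norm x > R \<longrightarrow> f x = 0)"
proof (intro iffI conjI)
  assume f: "test_function f"
  then show "smooth f"
    by (simp add: test_function_def smooth_def)
  have "bounded (tsupport f)"
    using f by (simp add: test_function_def compact_imp_bounded)
  then obtain R where R: "\<And>x. x \<in> tsupport f \<Longrightarrow> norm x \<le> R"
    by (auto simp: bounded_iff)
  have "f x = 0" if "norm x > R" for x
  proof (rule ccontr)
    assume "f x \<noteq> 0"
    then have "x \<in> tsupport f"
      unfolding tsupport_def using closure_subset by fastforce
    then show False
      using R that by force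
  qed
  then show "\<exists>R. \<forall>x. norm x > R \<longrightarrow> f x = 0"
    by blast
next
  assume "smooth f \<and> (\<exists>R. \<forall>x. norm x > R \<longrightarrow> f x = 0)"
  then obtain R where f: "smooth f" and R: "\<And>x. norm x > R \<Longrightarrow> f x = 0"
    by auto
  have "{x. f x \<noteq> 0} \<subseteq> cball 0 R"
    using R by (force simp: not_less[symmetric])
  then show "test_function f"
    using f bounded_subset[OF bounded_cball] by (auto simp: test_function_def smooth_def tsupport_def compact_closure)
qed

lemma test_functionE:
  assumes "test_function f"
  obtains R where "R > 0" "\<And>x. norm x > R \<Longrightarrow> f x = 0"
proof -
  obtain R where "\<And>x. norm x > R \<Longrightarrow> f x = 0"
    using assms test_function_iff by metis
  then show ?thesis
    using that[of "max 1 R"] by auto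
qed

lemma test_function_smooth: "test_function f \<Longrightarrow> smooth f"
  by (simp add: test_function_iff)

lemma test_function_zero: "test_function (\<lambda>_. 0)"
  by (simp add: test_function_iff smooth_def Ck_const)

lemma test_function_add_scale:
  assumes "test_function f" "test_function g"
  shows "test_function (\<lambda>x. f x + c * g x)"
proof -
  obtain R S where "\<And>x. norm x > R \<Longrightarrow> f x = 0" "\<And>x. norm x > S \<Longrightarrow> g x = 0"
    using assms by (meson test_functionE)
  then have "\<forall>x. norm x > max R S \<longrightarrow> f x + c * g x = 0"
    by simp
  with assms show ?thesis
    unfolding test_function_iff by (blast intro: smooth_add_scale)
qed

lemma test_function_scale: "test_function g \<Longrightarrow> test_function (\<lambda>x. c * g x)"
  using test_function_add_scale[OF test_function_zero, of g c] by simp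

lemma dirderiv_eq_0_outside:
  assumes "\<And>x. norm x > R \<Longrightarrow> f x = 0" "norm x > R"
  shows "dirderiv b f x = 0"
proof -
  have "open {x::'a. norm x > R}"
    by (intro open_Collect_less continuous_intros)
  then have "dirderiv b f x = dirderiv b (\<lambda>_. 0) x"
    using assms by (intro dirderiv_cong_open[of "{x. norm x > R}"]) auto
  also have "\<dots> = 0"
    by (rule dirderiv_eqI) simp
  finally show ?thesis .
qed

lemma funpow_dirderiv_eq_0_outside:
  assumes "\<And>x. norm x > R \<Longrightarrow> f x = 0" "norm x > R"
  shows "(dirderiv b ^^ n) f x = 0"
  using assms(2) by (induction n arbitrary: x) (auto intro: dirderiv_eq_0_outside assms(1))

lemma test_function_dirderiv: "test_function f \<Longrightarrow> b \<in> Basis \<Longrightarrow> test_function (dirderiv b f)"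
  unfolding test_function_iff using smooth_dirderiv dirderiv_eq_0_outside by metis

lemma test_function_funpow_dirderiv:
  "test_function f \<Longrightarrow> b \<in> Basis \<Longrightarrow> test_function ((dirderiv b ^^ n) f)"
  by (induction n) (auto intro: test_function_dirderiv)

lemma funpow_dirderiv_add_scale:
  assumes "test_function f" "test_function g" "b \<in> Basis"
  shows "(dirderiv b ^^ n) (\<lambda>x. f x + c * g x)
    = (\<lambda>x. (dirderiv b ^^ n) f x + c * (dirderiv b ^^ n) g x)"
proof (induction n)
  case (Suc n)
  then show ?case
    using assms by (auto intro!: dirderiv_add_scale smooth_differentiable test_function_smooth
        test_function_funpow_dirderiv)
qed simp

lemma funpow_dirderiv_scale:
  assumes "test_function g" "b \<in> Basis"
  shows "(dirderiv b ^^ n) (\<lambda>x. c * g x) = (\<lambda>x. c * (dirderiv b ^^ n) g x)"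
proof -
  \<comment> \<open>With radius - 1 every point counts as lying outside the ball.\<close>
  have "(dirderiv b ^^ n) (\<lambda>_. 0) = (\<lambda>_. 0)"
    by (rule ext, rule funpow_dirderiv_eq_0_outside[of "- 1"]) (auto intro: less_le_trans[OF _ norm_ge_zero])
  then show ?thesis
    using funpow_dirderiv_add_scale[OF test_function_zero assms, of n c] by simp
qed

lemma test_function_bounded:
  assumes "test_function f"
  obtains C where "C > 0" "\<And>x. norm (f x) \<le> C"
proof -
  obtain R where R: "R > 0" "\<And>x. norm x > R \<Longrightarrow> f x = 0"
    using test_functionE[OF assms] by metis
  have "compact (f ` cball 0 R)"
    using continuous_on_subset[OF smooth_continuous[OF test_function_smooth[OF assms]] subset_UNIV]
    by (intro compact_continuous_image) auto
  then obtain C where C: "\<And>x. x \<in> cball 0 R \<Longrightarrow> norm (f x) \<le> C" "C > 0"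
    using compact_imp_bounded[of "f ` cball 0 R"] unfolding bounded_pos by blast
  have "norm (f x) \<le> C" for x
    using C R(2)[of x] by (cases "norm x > R") auto
  with C that show ?thesis by blast
qed

lemma test_function_measurable: "test_function f \<Longrightarrow> f \<in> borel_measurable borel"
  by (intro borel_measurable_continuous_onI smooth_continuous test_function_smooth)

lemma test_function_section:
  fixes \<phi> :: "'a::euclidean_space \<Rightarrow> complex"
  assumes \<phi>: "test_function \<phi>" and b: "b \<in> Basis"
  shows "test_function (\<lambda>r. \<phi> (p + r *\<^sub>R b))"
proof -
  obtain R where R: "R > 0" "\<And>x. norm x > R \<Longrightarrow> \<phi> x = 0"
    using test_functionE[OF \<phi>] by metis
  have "\<phi> (p + r *\<^sub>R b) = 0" if "norm r > R + norm p" for r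
  proof (rule R(2))
    have "norm (r *\<^sub>R b) - norm p \<le> norm (p + r *\<^sub>R b)"
      using norm_diff_ineq[of "r *\<^sub>R b" p] by (simp add: add.commute)
    then show "R < norm (p + r *\<^sub>R b)"
      using that b by simp
  qed
  moreover have "smooth (\<lambda>r. \<phi> (p + r *\<^sub>R b))"
    by (intro smooth_affine test_function_smooth \<phi>) (simp add: linear_iff scaleR_add_left)
  ultimately show ?thesis
    unfolding test_function_iff by blast
qed

lemma funpow_dirderiv_section:
  assumes "test_function \<phi>" "b \<in> Basis"
  shows "(dirderiv 1 ^^ n) (\<lambda>r. \<phi> (p + r *\<^sub>R b)) = (\<lambda>r. (dirderiv b ^^ n) \<phi> (p + r *\<^sub>R b))"
proof (induction n)
  case (Suc n)
  have "smooth ((dirderiv b ^^ n) \<phi>)"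
    using assms by (intro test_function_smooth test_function_funpow_dirderiv)
  then show ?case
    by (simp add: Suc.IH dirderiv_1_eqI[OF smooth_has_vector_derivative])
qed simp

lemma u_dir_Basis: "u_dir \<in> Basis" and v_dir_Basis: "v_dir \<in> Basis"
  by (simp_all add: u_dir_def v_dir_def Basis_prod_def)


section \<open>Integration against locally integrable weights\<close>

text \<open>The kernels x^(a - 1) with 0 < Re a < 1 are unbounded at the origin, so a weight is
  asked only to be integrable over bounded intervals.\<close>

definition loc_integrable :: "(real \<Rightarrow> complex) \<Rightarrow> bool" where
  "loc_integrable w \<longleftrightarrow> (\<forall>R. set_integrable lborel {-R..R} w)"

lemma integrable_loc_integrable_mult:
  fixes F :: "real \<Rightarrow> complex"
  assumes w: "loc_integrable w" and F: "F \<in> borel_measurable borel"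
    and C: "\<And>x. norm (F x) \<le> C" and R: "\<And>x. \<bar>x\<bar> > R \<Longrightarrow> F x = 0"
  shows "integrable lborel (\<lambda>x. w x * F x)"
proof -
  have int: "integrable lborel (\<lambda>x. indicator {-R..R} x *\<^sub>R w x)"
    using w by (auto simp: loc_integrable_def set_integrable_def)
  \<comment> \<open>\<open>F\<close> vanishes off [-R, R], so the weight may be cut off there; the
    cut weight times the constant \<open>C\<close> then dominates.\<close>
  have eq: "w x * F x = (indicator {-R..R} x *\<^sub>R w x) * F x" for x
    using R[of x] by (cases "\<bar>x\<bar> > R") (auto simp: indicator_def)
  show ?thesis
    unfolding eq
  proof (rule Bochner_Integration.integrable_bound)
    show "integrable lborel (\<lambda>x. (indicator {-R..R} x *\<^sub>R w x) * of_real C)"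
      using int by (rule integrable_mult_left)
    show "(\<lambda>x. (indicator {-R..R} x *\<^sub>R w x) * F x) \<in> borel_measurable lborel"
      using borel_measurable_integrable[OF int] F by (intro borel_measurable_times) simp_all
    show "AE x in lborel. norm ((indicator {-R..R} x *\<^sub>R w x) * F x)
        \<le> norm ((indicator {-R..R} x *\<^sub>R w x) * of_real C)"
      using C by (auto simp: norm_mult intro!: AE_I2 mult_left_mono intro: order_trans[OF C])
  qed
qed

lemma integrable_loc_integrable_test_function:
  assumes "loc_integrable w" and f: "test_function f"
  shows "integrable lborel (\<lambda>x. w x * f x)"
proof -
  obtain R where "\<And>x. norm x > R \<Longrightarrow> f x = 0"
    using test_functionE[OF f] by metis
  moreover obtain C where "\<And>x. norm (f x) \<le> C"
    using test_function_bounded[OF f] by metis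
  ultimately show ?thesis
    using assms by (intro integrable_loc_integrable_mult[of w f C R] test_function_measurable) auto
qed

section \<open>Differentiation under the integral sign\<close>

text \<open>Dominated convergence, applied to the first-order remainder \<open>Q\<close> divided by
  the size of the increment. The mean value inequality on the convex set \<open>S\<close> supplies a
  dominating function that does not depend on the increment.\<close>

lemma has_vector_derivative_lebesgue_integral:
  fixes F F' :: "real \<Rightarrow> 'a \<Rightarrow> complex"
  assumes S: "open S" "convex S" "x \<in> S"
    and int: "\<And>u. u \<in> S \<Longrightarrow> integrable M (F u)"
    and F'x: "F' x \<in> borel_measurable M"
    and deriv: "\<And>u v. u \<in> S \<Longrightarrow> ((\<lambda>u. F u v) has_vector_derivative F' u v) (at u)"
    and bound: "\<And>u v. u \<in> S \<Longrightarrow> norm (F' u v) \<le> W v" and W: "integrable M W"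
  shows "((\<lambda>u. LINT v|M. F u v) has_vector_derivative (LINT v|M. F' x v)) (at x)"
proof -
  define Q where "Q u v = (1 / norm (u - x)) *\<^sub>R (F u v - (F x v + (u - x) *\<^sub>R F' x v))" for u v
  have bnd: "norm (F u v - F x v) \<le> W v * \<bar>u - x\<bar>" if "u \<in> S" for u v
  proof -
    have "norm (F u v - F x v) \<le> W v * norm (u - x)"
    proof (rule differentiable_bound[of S _ "\<lambda>t h. h *\<^sub>R F' t v"])
      fix t assume t: "t \<in> S"
      show "((\<lambda>u. F u v) has_derivative (\<lambda>h. h *\<^sub>R F' t v)) (at t within S)"
        using deriv[OF t] by (auto simp: has_vector_derivative_def intro: has_derivative_at_withinI)
      show "onorm (\<lambda>h. h *\<^sub>R F' t v) \<le> W v"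
        using bound[OF t, of v] by (intro onorm_le) (simp add: mult.commute mult_left_mono)
    qed (use S that in auto)
    then show ?thesis by simp
  qed
  have "integrable M (F' x)"
    using W F'x
    by (rule Bochner_Integration.integrable_bound) (auto intro!: AE_I2 order_trans[OF bound[OF S(3)]])
  note intx = int[OF S(3)] this
  have Q_int: "(LINT v|M. Q u v)
      = (1 / norm (u - x)) *\<^sub>R ((LINT v|M. F u v) - ((LINT v|M. F x v) + (u - x) *\<^sub>R (LINT v|M. F' x v)))"
    if "u \<in> S" for u
    unfolding Q_def using int[OF that] intx by simp
  \<comment> \<open>Dominated convergence concerns sequences, so the limit is tested along arbitrary
    sequences in \<open>S\<close> that tend to \<open>x\<close>.\<close>
  have "((\<lambda>u. LINT v|M. Q u v) \<longlongrightarrow> 0) (at x within S)"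
    unfolding tendsto_at_iff_sequentially
  proof (intro allI impI)
    fix X assume XS: "\<forall>i. X i \<in> S - {x}" and X: "X \<longlonglongrightarrow> x"
    have "(\<lambda>i. LINT v|M. Q (X i) v) \<longlonglongrightarrow> (LINT v|M. 0)"
    proof (rule integral_dominated_convergence)
      show "Q (X i) \<in> borel_measurable M" for i
        unfolding Q_def using int[of "X i"] intx XS by auto
      show "integrable M (\<lambda>v. 2 * W v)"
        using W by simp
      show "AE v in M. (\<lambda>i. Q (X i) v) \<longlonglongrightarrow> 0"
      proof (intro AE_I2)
        fix v
        have "((\<lambda>u. Q u v) \<longlongrightarrow> 0) (at x)"
          using deriv[OF S(3), of v] by (simp add: has_vector_derivative_def has_derivative_within Q_def)
        then have "((\<lambda>u. Q u v) \<circ> X) \<longlonglongrightarrow> 0"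
          unfolding tendsto_at_iff_sequentially using X XS by auto
        then show "(\<lambda>i. Q (X i) v) \<longlonglongrightarrow> 0"
          by (simp add: comp_def)
      qed
      \<comment> \<open>One \<open>W v\<close> bounds the difference quotient of \<open>F\<close>,
        the other the derivative \<open>F' x v\<close>.\<close>
      show "AE v in M. norm (Q (X i) v) \<le> 2 * W v" for i
      proof (intro AE_I2)
        fix v
        have pos: "\<bar>X i - x\<bar> > 0"
          using XS by auto
        have "norm (F (X i) v - (F x v + (X i - x) *\<^sub>R F' x v))
            \<le> norm (F (X i) v - F x v) + norm ((X i - x) *\<^sub>R F' x v)"
          by (metis diff_diff_eq norm_triangle_ineq4)
        also have "\<dots> \<le> W v * \<bar>X i - x\<bar> + \<bar>X i - x\<bar> * W v"
          using bnd[of "X i" v] XS bound[OF S(3), of v] by (intro add_mono) (auto intro: mult_left_mono)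
        finally show "norm (Q (X i) v) \<le> 2 * W v"
          using pos unfolding Q_def norm_scaleR by (simp add: divide_simps mult_ac)
      qed
    qed simp
    then show "((\<lambda>u. LINT v|M. Q u v) \<circ> X) \<longlonglongrightarrow> 0"
      by (simp add: comp_def)
  qed
  then have "((\<lambda>u. (1 / norm (u - x)) *\<^sub>R ((LINT v|M. F u v)
      - ((LINT v|M. F x v) + (u - x) *\<^sub>R (LINT v|M. F' x v)))) \<longlongrightarrow> 0) (at x within S)"
    by (rule tendsto_cong[THEN iffD1, rotated]) (auto simp: eventually_at_filter Q_int)
  then have "((\<lambda>u. LINT v|M. F u v) has_vector_derivative (LINT v|M. F' x v)) (at x within S)"
    unfolding has_vector_derivative_def has_derivative_within
    by (auto intro: bounded_linear_scaleR_left)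
  then show ?thesis
    by (simp only: at_within_open[OF S(3) S(1)])
qed

text \<open>Bounds and radius are uniform over the open set \<open>S\<close> rather than over the
  whole line, because the translates of a test function have no common radius.\<close>

lemma has_vector_derivative_weighted_integral:
  fixes F F' :: "real \<Rightarrow> real \<Rightarrow> complex"
  assumes S: "open S" "convex S" "x \<in> S" and w: "loc_integrable w"
    and F: "\<And>u. u \<in> S \<Longrightarrow> F u \<in> borel_measurable borel" and F'x: "F' x \<in> borel_measurable borel"
    and deriv: "\<And>u v. u \<in> S \<Longrightarrow> ((\<lambda>u. F u v) has_vector_derivative F' u v) (at u)"
    and C: "\<And>u v. u \<in> S \<Longrightarrow> norm (F u v) \<le> C" and C': "\<And>u v. u \<in> S \<Longrightarrow> norm (F' u v) \<le> C'"
    and R: "\<And>u v. u \<in> S \<Longrightarrow> \<bar>v\<bar> > R \<Longrightarrow> F u v = 0" "\<And>u v. u \<in> S \<Longrightarrow> \<bar>v\<bar> > R \<Longrightarrow> F' u v = 0"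
  shows "((\<lambda>u. LINT v|lborel. w v * F u v) has_vector_derivative (LINT v|lborel. w v * F' x v)) (at x)"
proof (rule has_vector_derivative_lebesgue_integral[of S])
  have int: "integrable lborel (\<lambda>x. indicator {-R..R} x *\<^sub>R w x)"
    using w by (auto simp: loc_integrable_def set_integrable_def)
  show "integrable lborel (\<lambda>v. w v * F u v)" if "u \<in> S" for u
    using that by (intro integrable_loc_integrable_mult[of _ _ C R] w F C R)
  have "integrable lborel (\<lambda>v. w v * F' x v)"
    by (intro integrable_loc_integrable_mult[of _ _ C' R] w F'x C' R S)
  then show "(\<lambda>v. w v * F' x v) \<in> borel_measurable lborel"
    by (rule borel_measurable_integrable)
  show "((\<lambda>u. w v * F u v) has_vector_derivative w v * F' u v) (at u)" if "u \<in> S" for u v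
    by (intro has_vector_derivative_mult_right deriv that)
  show "integrable lborel (\<lambda>v. norm (indicator {-R..R} v *\<^sub>R w v) * C')"
    using int by (intro integrable_mult_left integrable_norm)
  show "norm (w v * F' u v) \<le> norm (indicator {-R..R} v *\<^sub>R w v) * C'" if "u \<in> S" for u v
    using R(2)[OF that, of v] C'[OF that, of v]
    by (cases "\<bar>v\<bar> > R") (auto simp: norm_mult indicator_def mult_left_mono)
qed (use S in auto)

lemma test_function_curry:
  fixes \<phi> :: "real \<times> real \<Rightarrow> complex"
  assumes "test_function \<phi>"
  shows test_function_curry_fst: "test_function (\<lambda>u. \<phi> (u, v))"
    and test_function_curry_snd: "test_function (\<lambda>v. \<phi> (u, v))"
  using test_function_section[OF assms u_dir_Basis, of "(0, v)"]
    test_function_section[OF assms v_dir_Basis, of "(u, 0)"]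
  by (simp_all add: u_dir_def v_dir_def)

lemma weighted_integral_deriv:
  assumes \<phi>: "test_function \<phi>" and w: "loc_integrable w"
  shows "((\<lambda>u. LINT v|lborel. w v * \<phi> (u, v)) has_vector_derivative
    (LINT v|lborel. w v * dirderiv u_dir \<phi> (u, v))) (at u)"
proof -
  note \<phi>' = test_function_dirderiv[OF \<phi> u_dir_Basis]
  obtain R where R: "\<And>x. norm x > R \<Longrightarrow> \<phi> x = 0"
    using test_functionE[OF \<phi>] by metis
  have R': "\<And>x. norm x > R \<Longrightarrow> dirderiv u_dir \<phi> x = 0"
    using dirderiv_eq_0_outside[of R \<phi>] R by blast
  have le: "norm (u, v) > R" if "\<bar>v\<bar> > R" for u v :: real
    using that norm_snd_le[of v u] by simp
  obtain C C' where C: "\<And>x. norm (\<phi> x) \<le> C" "\<And>x. norm (dirderiv u_dir \<phi> x) \<le> C'"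
    using test_function_bounded[OF \<phi>] test_function_bounded[OF \<phi>'] by metis
  have deriv: "((\<lambda>u. \<phi> (u, v)) has_vector_derivative dirderiv u_dir \<phi> (u, v)) (at u)" for u v
    using smooth_has_vector_derivative[OF test_function_smooth[OF \<phi>], of "(0, v)" u_dir u]
    by (simp add: u_dir_def)
  show ?thesis
    \<comment> \<open>The support of \<open>\<phi>\<close> is bounded in the plane, so one radius in
      v serves every u.\<close>
    by (rule has_vector_derivative_weighted_integral[where S = UNIV and R = R])
      (auto intro!: w deriv C R R' le test_function_measurable test_function_curry \<phi> \<phi>')
qed

lemma test_function_weighted_integral:
  fixes \<phi> :: "real \<times> real \<Rightarrow> complex"
  assumes \<phi>: "test_function \<phi>" and w: "loc_integrable w"
  shows "test_function (\<lambda>u. LINT v|lborel. w v * \<phi> (u, v))"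
  unfolding test_function_iff
proof
  show "smooth (\<lambda>u. LINT v|lborel. w v * \<phi> (u, v))"
  \<comment> \<open>The class holds the integrals of all test functions against the fixed weight,
    since each differentiation changes the integrand.\<close>
  proof (rule smooth_coinduct[of "\<lambda>G. \<exists>\<phi>. test_function \<phi> \<and> G = (\<lambda>u. LINT v|lborel. w v * \<phi> (u, v))"])
    fix G :: "real \<Rightarrow> complex"
    assume "\<exists>\<phi>. test_function \<phi> \<and> G = (\<lambda>u. LINT v|lborel. w v * \<phi> (u, v))"
    then obtain \<phi> where \<phi>: "test_function \<phi>" and G: "G = (\<lambda>u. LINT v|lborel. w v * \<phi> (u, v))"
      by blast
    note D = weighted_integral_deriv[OF \<phi> w, folded G]
    have "dirderiv 1 G = (\<lambda>u. LINT v|lborel. w v * dirderiv u_dir \<phi> (u, v))"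
      using dirderiv_1_eqI[OF D] by auto
    then show "(\<forall>x. G differentiable at x) \<and>
        (\<forall>b\<in>Basis. \<exists>\<phi>. test_function \<phi> \<and> dirderiv b G = (\<lambda>u. LINT v|lborel. w v * \<phi> (u, v)))"
      using D test_function_dirderiv[OF \<phi> u_dir_Basis]
      by (auto simp: has_vector_derivative_def differentiable_def)
  qed (use \<phi> in blast)
  obtain R where R: "\<And>x. norm x > R \<Longrightarrow> \<phi> x = 0"
    using test_functionE[OF \<phi>] by metis
  have "norm (u, v) > R" if "norm u > R" for u v :: real
    using that norm_fst_le[of u v] by simp
  then have "\<forall>u. norm u > R \<longrightarrow> (LINT v|lborel. w v * \<phi> (u, v)) = 0"
    using R by simp
  then show "\<exists>R. \<forall>u. norm u > R \<longrightarrow> (LINT v|lborel. w v * \<phi> (u, v)) = 0"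
    by blast
qed

lemma funpow_dirderiv_weighted_integral:
  assumes \<phi>: "test_function \<phi>" and w: "loc_integrable w"
  shows "(dirderiv 1 ^^ n) (\<lambda>u. LINT v|lborel. w v * \<phi> (u, v))
    = (\<lambda>u. LINT v|lborel. w v * (dirderiv u_dir ^^ n) \<phi> (u, v))"
proof (induction n)
  case (Suc n)
  show ?case
    using dirderiv_1_eqI[OF weighted_integral_deriv[OF test_function_funpow_dirderiv[OF \<phi> u_dir_Basis] w]]
    by (simp add: Suc.IH)
qed simp

lemma weighted_translate_deriv:
  fixes f :: "real \<Rightarrow> complex"
  assumes f: "test_function f" and w: "loc_integrable w"
  shows "((\<lambda>x. LINT r|lborel. w r * f (x + r)) has_vector_derivative
    (LINT r|lborel. w r * dirderiv 1 f (x + r))) (at x)"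
proof -
  have f': "test_function (dirderiv 1 f)"
    using test_function_dirderiv[OF f] by simp
  obtain R where R: "\<And>x. norm x > R \<Longrightarrow> f x = 0"
    using test_functionE[OF f] by metis
  have R': "\<And>x. norm x > R \<Longrightarrow> dirderiv 1 f x = 0"
    using dirderiv_eq_0_outside[of R f] R by blast
  obtain C C' where C: "\<And>x. norm (f x) \<le> C" "\<And>x. norm (dirderiv 1 f x) \<le> C'"
    using test_function_bounded[OF f] test_function_bounded[OF f'] by metis
  have deriv: "((\<lambda>u. f (u + v)) has_vector_derivative dirderiv 1 f (u + v)) (at u)" for u v
    using smooth_has_vector_derivative[OF test_function_smooth[OF f], of v 1 u]
    by (simp add: add.commute)
  have tr: "test_function (\<lambda>r. g (x + r))" if "test_function g" for g :: "real \<Rightarrow> complex" and x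
    using test_function_section[OF that, of 1 x] by simp
  show ?thesis
    \<comment> \<open>For |u - x| < 1 and |v| > R + |x| + 1 the sum u + v lies outside
      [-R, R].\<close>
    by (rule has_vector_derivative_weighted_integral[where S = "{x - 1<..<x + 1}" and R = "R + \<bar>x\<bar> + 1"])
      (auto intro!: w deriv C R R' test_function_measurable tr f f')
qed

lemma funpow_dirderiv_weighted_translate:
  fixes f :: "real \<Rightarrow> complex"
  assumes f: "test_function f" and w: "loc_integrable w"
  shows "(dirderiv 1 ^^ n) (\<lambda>x. LINT r|lborel. w r * f (x + r))
    = (\<lambda>x. LINT r|lborel. w r * (dirderiv 1 ^^ n) f (x + r))"
proof (induction n)
  case (Suc n)
  show ?case
    using dirderiv_1_eqI[OF weighted_translate_deriv[OF test_function_funpow_dirderiv[OF f] w]]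
    by (simp add: Suc.IH)
qed simp

text \<open>\<open>\<phi>\<close> is bounded and vanishes outside the square [-R, R] x [-R, R].
  Cutting both weights to [-R, R] therefore changes nothing, and the product of the cut weights is
  integrable over the plane.\<close>

lemma integrable_loc_integrable_prod:
  fixes \<phi> :: "real \<times> real \<Rightarrow> complex"
  assumes w1: "loc_integrable w1" and w2: "loc_integrable w2" and \<phi>: "test_function \<phi>"
  shows "integrable (lborel \<Otimes>\<^sub>M lborel) (\<lambda>(u, v). w1 u * (w2 v * \<phi> (u, v)))"
proof -
  obtain R where R: "\<And>x. norm x > R \<Longrightarrow> \<phi> x = 0"
    using test_functionE[OF \<phi>] by metis
  obtain C where C: "\<And>x. norm (\<phi> x) \<le> C"
    using test_function_bounded[OF \<phi>] by metis
  define v1 v2 where "v1 u = indicator {-R..R} u *\<^sub>R w1 u" and "v2 u = indicator {-R..R} u *\<^sub>R w2 u" for u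
  have int: "integrable lborel v1" "integrable lborel v2"
    using w1 w2 unfolding v1_def v2_def by (auto simp: loc_integrable_def set_integrable_def)
  then have [measurable]: "v1 \<in> borel_measurable borel" "v2 \<in> borel_measurable borel"
    by (auto dest: borel_measurable_integrable)
  have [measurable]: "\<phi> \<in> borel_measurable borel"
    by (rule test_function_measurable[OF \<phi>])
  have "\<phi> \<in> borel_measurable (lborel \<Otimes>\<^sub>M lborel)"
    by (simp add: lborel_prod)
  note [measurable] = this
  have eq: "w1 u * (w2 v * \<phi> (u, v)) = v1 u * (v2 v * \<phi> (u, v))" for u v
  proof (cases "norm (u, v) > R")
    case False
    then have "u \<in> {-R..R}" "v \<in> {-R..R}"
      using norm_fst_le[of u v] norm_snd_le[of v u] by auto
    then show ?thesis
      by (simp add: v1_def v2_def)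
  qed (simp add: R)
  have int2: "integrable (lborel \<Otimes>\<^sub>M lborel) (\<lambda>(u, v). v1 u * v2 v)"
    by (rule lborel_pair.Fubini_integrable)
      (auto simp: norm_mult intro!: integrable_mult_left integrable_mult_right int integrable_norm)
  have "integrable (lborel \<Otimes>\<^sub>M lborel) (\<lambda>(u, v). v1 u * (v2 v * \<phi> (u, v)))"
  proof (rule Bochner_Integration.integrable_bound)
    show "integrable (lborel \<Otimes>\<^sub>M lborel) (\<lambda>p. (case p of (u, v) \<Rightarrow> v1 u * v2 v) * of_real C)"
      using int2 by (rule integrable_mult_left)
    show "(\<lambda>(u, v). v1 u * (v2 v * \<phi> (u, v))) \<in> borel_measurable (lborel \<Otimes>\<^sub>M lborel)"
      by measurable
    show "AE p in lborel \<Otimes>\<^sub>M lborel. norm (case p of (u, v) \<Rightarrow> v1 u * (v2 v * \<phi> (u, v)))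
        \<le> norm ((case p of (u, v) \<Rightarrow> v1 u * v2 v) * of_real C)"
      by (auto simp: norm_mult mult.assoc intro!: AE_I2 mult_left_mono order_trans[OF C])
  qed
  then show ?thesis
    by (simp add: eq)
qed


section \<open>The kernels\<close>

lemma frac_kernel_nonpos: "x \<le> 0 \<Longrightarrow> frac_kernel a x = 0"
  by (simp add: frac_kernel_def heaviside_def)

text \<open>\<open>rGamma\<close> is entire, so this form suits every \<open>a\<close>. At a pole
  \<open>Gamma a\<close> is 0 by convention, and division by it gives 0, in agreement with
  \<open>rGamma a\<close>.\<close>

lemma frac_kernel_pos: "x > 0 \<Longrightarrow> frac_kernel a x = of_real x powr (a - 1) * rGamma a"
  by (simp add: frac_kernel_def heaviside_def rGamma_inverse_Gamma divide_inverse)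

lemma frac_kernel_measurable [measurable]: "frac_kernel a \<in> borel_measurable borel"
proof -
  have "frac_kernel a = (\<lambda>x. if 0 < x then exp ((a - 1) * of_real (ln x)) * rGamma a else 0)"
    by (auto simp: fun_eq_iff frac_kernel_nonpos frac_kernel_pos powr_def Ln_of_real not_less)
  then show ?thesis
    by simp
qed

text \<open>Euler's integral divided by \<open>Gamma a\<close>. That the value is 1 for every
  admissible \<open>a\<close> later fixes the constant in the convolution of two kernels.\<close>

lemma has_bochner_integral_frac_kernel_exp:
  assumes a: "Re a > 0"
  shows "has_bochner_integral lborel (\<lambda>x. frac_kernel a x * exp (- of_real x)) 1"
proof -
  let ?f = "\<lambda>x. frac_kernel a x * exp (- of_real x)"
  have G: "Gamma a \<noteq> 0"
    using a by (auto simp: Gamma_eq_zero_iff elim!: nonpos_Ints_cases)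
  have eq: "?f x = indicator {0<..} x *\<^sub>R (of_real x powr (a - 1) / of_real (exp x)) / Gamma a" for x
    by (auto simp: indicator_def frac_kernel_def heaviside_def exp_minus exp_of_real divide_inverse)
  have "set_integrable lebesgue {0<..} (\<lambda>x. complex_of_real x powr (a - 1) / of_real (exp x))"
    using absolutely_integrable_Gamma_integral'[OF a] by simp
  then have "integrable lebesgue ?f"
    unfolding eq set_integrable_def by simp
  \<comment> \<open>Integrability descends from the completed measure because the integrand is Borel
    measurable.\<close>
  then have int: "integrable lborel ?f"
    by (subst (asm) integrable_completion) auto
  have "((\<lambda>x. of_real x powr (a - 1) / of_real (exp x) / Gamma a) has_integral (Gamma a / Gamma a)) {0<..}"
    by (intro has_integral_divide Gamma_integral_complex' a)
  then have "(?f has_integral Gamma a / Gamma a) {0<..}"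
    by (rule has_integral_eq[rotated]) (simp add: eq)
  then have "(?f has_integral Gamma a / Gamma a) UNIV"
    by (rule has_integral_on_superset) (auto simp: frac_kernel_nonpos)
  then have "(?f has_integral 1) UNIV"
    using G by simp
  then have "integral\<^sup>L lborel ?f = 1"
    using has_integral_unique has_integral_integral_lborel[OF int] by blast
  then show ?thesis
    using int by (simp add: has_bochner_integral_iff)
qed

lemma integrable_frac_kernel_exp:
  "Re a > 0 \<Longrightarrow> integrable lborel (\<lambda>x. frac_kernel a x * exp (- of_real x))"
  using has_bochner_integral_frac_kernel_exp has_bochner_integral_iff by blast

text \<open>For x \<le> R the factor exp (R - x) is at least 1, so the exponentially damped kernel
  times exp R dominates.\<close>

lemma loc_integrable_frac_kernel:
  assumes a: "Re a > 0"
  shows "loc_integrable (frac_kernel a)"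
  unfolding loc_integrable_def set_integrable_def
proof
  fix R :: real
  show "integrable lborel (\<lambda>x. indicator {-R..R} x *\<^sub>R frac_kernel a x)"
  proof (rule Bochner_Integration.integrable_bound)
    show "integrable lborel (\<lambda>x. (frac_kernel a x * exp (- of_real x)) * of_real (exp R))"
      by (intro integrable_mult_left integrable_frac_kernel_exp a)
    show "AE x in lborel. norm (indicator {-R..R} x *\<^sub>R frac_kernel a x)
        \<le> norm ((frac_kernel a x * exp (- of_real x)) * of_real (exp R))"
    proof (intro AE_I2)
      fix x :: real
      have "1 \<le> exp (- x) * exp R" if "x \<le> R"
        using that by (simp add: exp_add[symmetric])
      then have "norm (frac_kernel a x) * 1 \<le> norm (frac_kernel a x) * (exp (- x) * exp R)" if "x \<le> R"
        using that by (intro mult_left_mono) auto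
      then show "norm (indicator {-R..R} x *\<^sub>R frac_kernel a x)
          \<le> norm ((frac_kernel a x * exp (- of_real x)) * of_real (exp R))"
        by (auto simp: indicator_def norm_mult mult.assoc)
    qed
  qed measurable
qed

text \<open>The recursion a * \<open>rGamma (a + 1)\<close> = \<open>rGamma a\<close> holds for
  every complex a, so the poles of \<open>Gamma\<close> need no separate case.\<close>

lemma frac_kernel_has_vector_derivative:
  assumes x: "x > 0"
  shows "(frac_kernel (a + 1) has_vector_derivative frac_kernel a x) (at x)"
proof -
  have "((\<lambda>z. z powr a) has_field_derivative a * of_real x powr (a - 1)) (at (complex_of_real x))"
    using x by (intro has_field_derivative_powr) (auto simp: complex_nonpos_Reals_iff)
  then have "((\<lambda>z. z powr a * rGamma (a + 1)) has_field_derivative a * of_real x powr (a - 1) * rGamma (a + 1))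
      (at (complex_of_real x))"
    by (rule DERIV_cmult_right)
  then have "((\<lambda>x. of_real x powr a * rGamma (a + 1)) has_vector_derivative
      a * of_real x powr (a - 1) * rGamma (a + 1)) (at x)"
    by (rule has_vector_derivative_real_field)
  also have "a * of_real x powr (a - 1) * rGamma (a + 1) = frac_kernel a x"
    using x rGamma_plus1[of a, symmetric] by (simp add: frac_kernel_pos mult_ac)
  finally show ?thesis
    by (rule has_vector_derivative_transform_within_open[of _ _ _ "{0<..}"])
      (use x in \<open>auto simp: frac_kernel_pos\<close>)
qed

lemma frac_kernel_continuous_at: "x > 0 \<Longrightarrow> isCont (frac_kernel a) x"
  using frac_kernel_has_vector_derivative[of x "a - 1"] by (auto dest: has_vector_derivative_continuous)

text \<open>With Re a > 0 the power x^a tends to 0 at the origin, which is the value that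
  \<open>heaviside\<close> assigns there.\<close>

lemma continuous_on_frac_kernel:
  assumes "Re a > 0"
  shows "continuous_on {0..} (frac_kernel (a + 1))"
proof -
  have "continuous_on {0..} (\<lambda>x. complex_of_real x powr a * rGamma (a + 1))"
    using assms by (intro continuous_intros) auto
  moreover have "complex_of_real x powr a * rGamma (a + 1) = frac_kernel (a + 1) x" if "x \<in> {0..}" for x
    using that by (cases "x = 0") (auto simp: frac_kernel_pos frac_kernel_nonpos)
  ultimately show ?thesis
    by (rule continuous_on_eq)
qed

text \<open>For \<open>Re a \<le> 0\<close> the kernel is not locally integrable, but away from the origin it agrees with a
  locally integrable function.\<close>

lemma frac_kernel_weight:
  assumes "Re a > 0 \<or> (\<exists>\<epsilon>>0. \<forall>x\<in>X. \<epsilon> \<le> \<bar>x\<bar>)"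
  obtains w where "loc_integrable w" "\<And>x. x \<in> X \<Longrightarrow> w x = frac_kernel a x"
proof (cases "Re a > 0")
  case True
  then show ?thesis
    using loc_integrable_frac_kernel that by blast
next
  case False
  then obtain \<epsilon> where \<epsilon>: "\<epsilon> > 0" "\<And>x. x \<in> X \<Longrightarrow> \<epsilon> \<le> \<bar>x\<bar>"
    using assms by blast
  define w where "w x = indicator {\<epsilon>..} x *\<^sub>R frac_kernel a x" for x
  have "set_integrable lborel {-R..R} w" for R
  proof -
    have "continuous_on {\<epsilon>..R} (frac_kernel a)"
      using \<epsilon>(1) by (intro continuous_at_imp_continuous_on ballI frac_kernel_continuous_at) auto
    then have "set_integrable lborel {\<epsilon>..R} (frac_kernel a)"
      unfolding set_integrable_def by (intro borel_integrable_compact) auto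
    moreover have "indicator {-R..R} x *\<^sub>R w x = indicator {\<epsilon>..R} x *\<^sub>R frac_kernel a x" for x
      using \<epsilon>(1) by (auto simp: w_def indicator_def)
    ultimately show ?thesis
      by (simp add: set_integrable_def)
  qed
  moreover have "w x = frac_kernel a x" if "x \<in> X" for x
    using \<epsilon>(1) \<epsilon>(2)[OF that] by (cases "x > 0") (auto simp: w_def frac_kernel_nonpos)
  ultimately show ?thesis
    using that by (auto simp: loc_integrable_def)
qed

text \<open>Only the values of the kernel where \<open>f\<close> is nonzero enter, and there it
  agrees with a locally integrable weight.\<close>

lemma integrable_frac_kernel_test_function:
  assumes f: "test_function f" and a: "Re a > 0 \<or> (\<exists>\<epsilon>>0. \<forall>x. \<bar>x\<bar> < \<epsilon> \<longrightarrow> f x = 0)"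
  shows "integrable lborel (\<lambda>x. frac_kernel a x * f x)"
proof -
  have "Re a > 0 \<or> (\<exists>\<epsilon>>0. \<forall>x\<in>{x. f x \<noteq> 0}. \<epsilon> \<le> \<bar>x\<bar>)"
    using a by (auto simp: not_less[symmetric])
  then obtain w where "loc_integrable w" and w: "\<And>x. x \<in> {x. f x \<noteq> 0} \<Longrightarrow> w x = frac_kernel a x"
    using frac_kernel_weight by metis
  then have "integrable lborel (\<lambda>x. w x * f x)"
    using f integrable_loc_integrable_test_function by blast
  moreover have "w x * f x = frac_kernel a x * f x" for x
    using w[of x] by auto
  ultimately show ?thesis
    by simp
qed

section \<open>Integration by parts against the kernels\<close>

text \<open>The fundamental theorem of calculus for the product of
  \<open>frac_kernel (a + 1)\<close> and \<open>f\<close> on [0, R + 1]. The product is continuous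
  up to 0, either because the kernel is or because \<open>f\<close> vanishes near 0.\<close>

lemma frac_kernel_integration_by_parts:
  assumes f: "test_function f" and a: "Re a > 0 \<or> (\<exists>\<epsilon>>0. \<forall>x. \<bar>x\<bar> < \<epsilon> \<longrightarrow> f x = 0)"
  shows "(LINT x|lborel. frac_kernel (a + 1) x * dirderiv 1 f x) = - (LINT x|lborel. frac_kernel a x * f x)"
proof -
  have f': "test_function (dirderiv 1 f)"
    using test_function_dirderiv[OF f] by simp
  have a': "Re (a + 1) > 0 \<or> (\<exists>\<epsilon>>0. \<forall>x. \<bar>x\<bar> < \<epsilon> \<longrightarrow> dirderiv 1 f x = 0)"
    using a
  proof (elim disjE exE conjE)
    fix \<epsilon> :: real assume \<epsilon>: "\<epsilon> > 0" "\<forall>x. \<bar>x\<bar> < \<epsilon> \<longrightarrow> f x = 0"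
    have "dirderiv 1 f x = 0" if "\<bar>x\<bar> < \<epsilon>" for x
    proof -
      have "dirderiv 1 f x = dirderiv 1 (\<lambda>_. 0) x"
        using \<epsilon> that by (intro dirderiv_cong_open[of "{-\<epsilon><..<\<epsilon>}"]) auto
      also have "\<dots> = 0"
        by (rule dirderiv_1_eqI) auto
      finally show ?thesis .
    qed
    then show ?thesis
      using \<epsilon> by blast
  qed simp
  let ?g = "\<lambda>x. frac_kernel (a + 1) x * dirderiv 1 f x + frac_kernel a x * f x"
  note int = integrable_frac_kernel_test_function[OF f' a'] integrable_frac_kernel_test_function[OF f a]
  obtain R where R: "R > 0" "\<And>x. norm x > R \<Longrightarrow> f x = 0"
    using test_functionE[OF f] by metis
  have R': "\<And>x. norm x > R \<Longrightarrow> dirderiv 1 f x = 0"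
    using dirderiv_eq_0_outside[of R f] R by blast
  have cf: "continuous_on S f" for S
    using smooth_continuous[OF test_function_smooth[OF f]] continuous_on_subset by blast
  have "continuous_on {0..R+1} (\<lambda>x. frac_kernel (a + 1) x * f x)"
    using a
  proof (elim disjE exE conjE)
    assume "Re a > 0"
    then show ?thesis
      by (intro continuous_on_mult cf continuous_on_subset[OF continuous_on_frac_kernel]) auto
  next
    fix \<epsilon> :: real assume \<epsilon>: "\<epsilon> > 0" "\<forall>x. \<bar>x\<bar> < \<epsilon> \<longrightarrow> f x = 0"
    \<comment> \<open>Two open sets cover the interval: on the first the product is 0, on the second
      the kernel is continuous.\<close>
    have "continuous_on ({-\<epsilon><..<\<epsilon>} \<union> {0<..}) (\<lambda>x. frac_kernel (a + 1) x * f x)"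
    proof (rule continuous_on_open_Un)
      have "frac_kernel (a + 1) x * f x = 0" if "x \<in> {-\<epsilon><..<\<epsilon>}" for x
        using \<epsilon> that by auto
      then show "continuous_on {-\<epsilon><..<\<epsilon>} (\<lambda>x. frac_kernel (a + 1) x * f x)"
        by (intro continuous_on_eq[OF continuous_on_const[of _ 0]]) (simp del: mult_eq_0_iff)
      show "continuous_on {0<..} (\<lambda>x. frac_kernel (a + 1) x * f x)"
        by (intro continuous_on_mult cf continuous_at_imp_continuous_on[of "{0<..}" "frac_kernel _"])
          (auto intro: frac_kernel_continuous_at)
    qed auto
    then show ?thesis
      by (rule continuous_on_subset) (use \<epsilon> in auto)
  qed
  then have "(?g has_integral frac_kernel (a + 1) (R + 1) * f (R + 1) - frac_kernel (a + 1) 0 * f 0) {0..R+1}"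
    using R(1)
    by (intro fundamental_theorem_of_calculus_interior has_vector_derivative_mult
        frac_kernel_has_vector_derivative smooth_has_vector_derivative_1 test_function_smooth f) auto
  \<comment> \<open>The boundary terms vanish: the kernel is 0 at the point 0, and R + 1 lies
    strictly beyond the support of \<open>f\<close>.\<close>
  then have "(?g has_integral 0) {0..R+1}"
    using R by (simp add: frac_kernel_nonpos)
  then have "(?g has_integral 0) UNIV"
  proof (rule has_integral_on_superset)
    show "?g x = 0" if "x \<notin> {0..R+1}" for x
      using that R(2)[of x] R'[of x] by (cases "x \<le> 0") (auto simp: frac_kernel_nonpos)
  qed simp
  moreover have "(?g has_integral integral\<^sup>L lborel ?g) UNIV"
    by (intro has_integral_integral_lborel Bochner_Integration.integrable_add int)
  ultimately have "integral\<^sup>L lborel ?g = 0"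
    using has_integral_unique by blast
  then show ?thesis
    using int by (simp add: eq_neg_iff_add_eq_0)
qed

text \<open>\<open>frac_kernel 1\<close> is the Heaviside function, and its jump at 0 leaves the
  boundary term - f 0. The preceding rule with a = 0 asks \<open>f\<close> to vanish near 0 and so
  cannot produce this term.\<close>

lemma frac_kernel_1_integral:
  assumes f: "test_function f"
  shows "(LINT x|lborel. frac_kernel 1 x * dirderiv 1 f x) = - f 0"
proof -
  have f': "test_function (dirderiv 1 f)"
    using test_function_dirderiv[OF f] by simp
  let ?g = "\<lambda>x. frac_kernel 1 x * dirderiv 1 f x"
  have int: "integrable lborel ?g"
    using integrable_frac_kernel_test_function[OF f', of 1] by simp
  obtain R where R: "R > 0" "\<And>x. norm x > R \<Longrightarrow> f x = 0"
    using test_functionE[OF f] by metis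
  have R': "\<And>x. norm x > R \<Longrightarrow> dirderiv 1 f x = 0"
    using dirderiv_eq_0_outside[of R f] R by blast
  have "continuous_on {0..R+1} f"
    using smooth_continuous[OF test_function_smooth[OF f]] continuous_on_subset by blast
  moreover have "(f has_vector_derivative ?g x) (at x)" if "x > 0" for x
    using smooth_has_vector_derivative_1[OF test_function_smooth[OF f], of x] that
    by (simp add: frac_kernel_pos)
  ultimately have "(?g has_integral f (R + 1) - f 0) {0..R+1}"
    using R(1) by (intro fundamental_theorem_of_calculus_interior) auto
  then have "(?g has_integral - f 0) {0..R+1}"
    using R by simp
  then have "(?g has_integral - f 0) UNIV"
  proof (rule has_integral_on_superset)
    show "?g x = 0" if "x \<notin> {0..R+1}" for x
      using that R'[of x] by (cases "x \<le> 0") (auto simp: frac_kernel_nonpos)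
  qed simp
  then show ?thesis
    using has_integral_unique has_integral_integral_lborel[OF int] by blast
qed

lemma frac_kernel_funpow_parts:
  assumes f: "test_function f" and a: "Re a > 0 \<or> (\<exists>\<epsilon>>0. \<forall>x. \<bar>x\<bar> < \<epsilon> \<longrightarrow> f x = 0)"
  shows "(LINT x|lborel. frac_kernel (a + of_nat n) x * (dirderiv 1 ^^ n) f x)
    = (- 1) ^ n * (LINT x|lborel. frac_kernel a x * f x)"
proof (induction n)
  case (Suc n)
  have "Re (a + of_nat n) > 0 \<or> (\<exists>\<epsilon>>0. \<forall>x. \<bar>x\<bar> < \<epsilon> \<longrightarrow> (dirderiv 1 ^^ n) f x = 0)"
    using a
  proof (elim disjE exE conjE)
    fix \<epsilon> :: real assume \<epsilon>: "\<epsilon> > 0" "\<forall>x. \<bar>x\<bar> < \<epsilon> \<longrightarrow> f x = 0"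
    have "dirderiv 1 (\<lambda>_. 0) = (\<lambda>x::real. 0)"
      by (rule ext, rule dirderiv_1_eqI) auto
    then have "(dirderiv 1 ^^ n) (\<lambda>_. 0) = (\<lambda>x::real. 0)"
      by (induction n) auto
    then have "(dirderiv 1 ^^ n) f x = 0" if "\<bar>x\<bar> < \<epsilon>" for x
      using \<epsilon> that funpow_dirderiv_cong_open[of "{-\<epsilon><..<\<epsilon>}" f "\<lambda>_. 0" x n 1]
      by (simp add: abs_less_iff)
    then show ?thesis
      using \<epsilon> by blast
  qed simp
  moreover have "test_function ((dirderiv 1 ^^ n) f)"
    by (intro test_function_funpow_dirderiv f) simp
  ultimately show ?case
    using frac_kernel_integration_by_parts[of "(dirderiv 1 ^^ n) f" "a + of_nat n"] Suc.IH
    by (simp add: add_ac)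
qed simp

text \<open>All derivatives but one are moved onto the kernel, which lowers it to
  \<open>frac_kernel 1\<close>. The case N = 0 is different, as \<open>frac_kernel 0\<close> is the
  zero function.\<close>

lemma frac_kernel_of_nat_integral:
  assumes f: "test_function f" and N: "N > 0"
  shows "(LINT x|lborel. frac_kernel (of_nat N) x * (dirderiv 1 ^^ N) f x) = (- 1) ^ N * f 0"
proof -
  obtain n where n: "N = Suc n"
    using N gr0_implies_Suc by blast
  have "test_function (dirderiv 1 f)"
    using test_function_dirderiv[OF f] by simp
  from frac_kernel_funpow_parts[OF this, of 1 n] show ?thesis
    by (simp add: n frac_kernel_1_integral[OF f] funpow_Suc_right del: funpow.simps)
qed


section \<open>Convolution of the kernels\<close>

lemma frac_kernel_scale:
  assumes t: "t > 0"
  shows "frac_kernel a (t * x) = of_real t powr (a - 1) * frac_kernel a x"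
proof (cases "x > 0")
  case True
  then show ?thesis
    using t by (simp add: frac_kernel_pos powr_times_real)
next
  case False
  then show ?thesis
    using t by (simp add: frac_kernel_nonpos mult_nonneg_nonpos)
qed

text \<open>By homogeneity of the kernels, the substitution r = t * x pulls all dependence on t out
  of the integral as t^(a + b - 1). The remaining constant, a Beta integral, is left unevaluated
  here.\<close>

lemma frac_kernel_convolution_aux:
  assumes a: "Re a > 0" and b: "Re b > 0"
  shows "(LINT r|lborel. frac_kernel a r * frac_kernel b (t - r))
    = (LINT x|lborel. frac_kernel a x * frac_kernel b (1 - x)) * Gamma (a + b) * frac_kernel (a + b) t"
proof (cases "t > 0")
  case True
  have "a + b \<notin> \<int>\<^sub>\<le>\<^sub>0"
    using a b by (auto elim!: nonpos_Ints_cases simp: complex_eq_iff)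
  then have k: "Gamma (a + b) * frac_kernel (a + b) t = of_real t powr (a + b - 1)"
    using True by (simp add: frac_kernel_pos rGamma_inverse_Gamma Gamma_eq_zero_iff)
  \<comment> \<open>The leading factor t is the Jacobian of r = t * x.\<close>
  have p: "of_real t * of_real t powr (a - 1) * of_real t powr (b - 1) = of_real t powr (a + b - 1)"
    using True by (simp add: powr_diff powr_add divide_simps)
  have "(LINT r|lborel. frac_kernel a r * frac_kernel b (t - r))
      = t *\<^sub>R (LINT x|lborel. frac_kernel a (t * x) * frac_kernel b (t - t * x))"
    using True lborel_integral_real_affine[of t "\<lambda>r. frac_kernel a r * frac_kernel b (t - r)" 0] by simp
  also have "(\<lambda>x. frac_kernel a (t * x) * frac_kernel b (t - t * x))
      = (\<lambda>x. (of_real t powr (a - 1) * of_real t powr (b - 1)) * (frac_kernel a x * frac_kernel b (1 - x)))"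
  proof
    fix x
    have "t - t * x = t * (1 - x)"
      by (simp add: algebra_simps)
    then show "frac_kernel a (t * x) * frac_kernel b (t - t * x)
      = (of_real t powr (a - 1) * of_real t powr (b - 1)) * (frac_kernel a x * frac_kernel b (1 - x))"
      by (simp add: frac_kernel_scale[OF True])
  qed
  also have "t *\<^sub>R (LINT x|lborel. (of_real t powr (a - 1) * of_real t powr (b - 1))
        * (frac_kernel a x * frac_kernel b (1 - x)))
      = (of_real t * of_real t powr (a - 1) * of_real t powr (b - 1))
        * (LINT x|lborel. frac_kernel a x * frac_kernel b (1 - x))"
    by (simp only: integral_mult_right_zero scaleR_conv_of_real mult.assoc)
  finally show ?thesis
    unfolding p k[symmetric] by (simp only: mult_ac)
next
  case False
  have "frac_kernel a r * frac_kernel b (t - r) = 0" for r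
    using False by (cases "r \<le> 0") (auto simp: frac_kernel_nonpos)
  then have "(LINT r|lborel. frac_kernel a r * frac_kernel b (t - r)) = 0"
    by (simp only: Bochner_Integration.integral_zero)
  then show ?thesis
    using False by (simp add: frac_kernel_nonpos)
qed

text \<open>By translation invariance the inner integral of the norm of \<open>q (t - r)\<close>
  does not depend on r, so integrability of \<open>p\<close> suffices for the outer one.\<close>

lemma integrable_convolution:
  fixes p q :: "real \<Rightarrow> complex"
  assumes p: "integrable lborel p" and q: "integrable lborel q"
  shows "integrable (lborel \<Otimes>\<^sub>M lborel) (\<lambda>(r, t). p r * q (t - r))"
proof (rule lborel_pair.Fubini_integrable)
  have [measurable]: "p \<in> borel_measurable borel" "q \<in> borel_measurable borel"
    using p q by (auto dest: borel_measurable_integrable)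
  show "(\<lambda>(r, t). p r * q (t - r)) \<in> borel_measurable (lborel \<Otimes>\<^sub>M lborel)"
    by measurable
  have int: "integrable lborel (\<lambda>t. q (t - r))" for r
    using lborel_integrable_real_affine[OF q, of 1 "- r"] by simp
  have "(LINT t|lborel. norm (q (t - r))) = (LINT t|lborel. norm (q t))" for r
    using lborel_integral_real_affine[of 1 "\<lambda>t. norm (q t)" "- r"] by simp
  then show "integrable lborel (\<lambda>r. LINT t|lborel. norm (case (r, t) of (r, t) \<Rightarrow> p r * q (t - r)))"
    using p by (simp add: norm_mult)
  show "AE r in lborel. integrable lborel (\<lambda>t. case (r, t) of (r, t) \<Rightarrow> p r * q (t - r))"
    using int by simp
qed

text \<open>Substituting s = t - r and exchanging the integrals leaves \<open>F\<close> integrated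
  against the convolution of the kernels. The exponential decay of \<open>F\<close> makes the
  exchange legitimate.\<close>

lemma frac_kernel_convolution_const:
  fixes F :: "real \<Rightarrow> complex"
  assumes a: "Re a > 0" and b: "Re b > 0" and [measurable]: "F \<in> borel_measurable borel"
    and C: "\<And>t. t > 0 \<Longrightarrow> norm (F t) \<le> C * exp (- t)"
  shows "(LINT r|lborel. frac_kernel a r * (LINT s|lborel. frac_kernel b s * F (r + s)))
    = (LINT x|lborel. frac_kernel a x * frac_kernel b (1 - x)) * Gamma (a + b)
      * (LINT t|lborel. frac_kernel (a + b) t * F t)" (is "_ = ?c * Gamma (a + b) * _")
proof -
  have int: "integrable (lborel \<Otimes>\<^sub>M lborel) (\<lambda>(r, t). frac_kernel a r * (frac_kernel b (t - r) * F t))"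
  proof (rule Bochner_Integration.integrable_bound)
    let ?G = "\<lambda>(r, t). frac_kernel a r * exp (- of_real r)
        * (frac_kernel b (t - r) * exp (- of_real (t - r)))"
    show "integrable (lborel \<Otimes>\<^sub>M lborel) (\<lambda>p. ?G p * of_real C)"
      by (intro integrable_mult_left integrable_convolution integrable_frac_kernel_exp a b)
    show "(\<lambda>(r, t). frac_kernel a r * (frac_kernel b (t - r) * F t)) \<in> borel_measurable (lborel \<Otimes>\<^sub>M lborel)"
      by measurable
    have "norm (frac_kernel a r * (frac_kernel b (t - r) * F t)) \<le> norm (frac_kernel a r * exp (- of_real r)
        * (frac_kernel b (t - r) * exp (- of_real (t - r))) * of_real C)" for r t
    \<comment> \<open>Outside 0 < r < t one of the kernels vanishes. Inside, exp (- t) splits into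
      exp (- r) * exp (- (t - r)), one factor to damp each kernel.\<close>
    proof (cases "r > 0 \<and> t - r > 0")
      case True
      then have "norm (F t) \<le> C * exp (- t)"
        by (intro C) auto
      also have "\<dots> \<le> \<bar>C\<bar> * (exp (- r) * exp (- (t - r)))"
        by (simp add: exp_add[symmetric] mult_right_mono)
      finally have "norm (frac_kernel a r) * (norm (frac_kernel b (t - r)) * norm (F t))
          \<le> norm (frac_kernel a r) * (norm (frac_kernel b (t - r)) * (\<bar>C\<bar> * (exp (- r) * exp (- (t - r)))))"
        by (intro mult_left_mono) auto
      then show ?thesis
        by (simp add: norm_mult mult_ac)
    qed (auto simp: frac_kernel_nonpos not_less)
    then show "AE p in lborel \<Otimes>\<^sub>M lborel. norm (case p of (r, t) \<Rightarrow> frac_kernel a r * (frac_kernel b (t - r) * F t))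
        \<le> norm (?G p * of_real C)"
      by (intro AE_I2) (simp only: case_prod_beta)
  qed
  have "(LINT s|lborel. frac_kernel b s * F (r + s)) = (LINT t|lborel. frac_kernel b (t - r) * F t)" for r
    using lborel_integral_real_affine[of 1 "\<lambda>s. frac_kernel b s * F (r + s)" "- r"] by simp
  then have "(LINT r|lborel. frac_kernel a r * (LINT s|lborel. frac_kernel b s * F (r + s)))
      = (LINT r|lborel. LINT t|lborel. frac_kernel a r * (frac_kernel b (t - r) * F t))"
    by simp
  also have "\<dots> = (LINT t|lborel. LINT r|lborel. frac_kernel a r * (frac_kernel b (t - r) * F t))"
    by (rule lborel_pair.Fubini_integral[OF int, symmetric])
  also have "\<dots> = (LINT t|lborel. (LINT r|lborel. frac_kernel a r * frac_kernel b (t - r)) * F t)"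
    by (simp add: mult.assoc[symmetric])
  also have "\<dots> = (LINT t|lborel. (?c * Gamma (a + b)) * (frac_kernel (a + b) t * F t))"
    by (subst frac_kernel_convolution_aux[OF a b]) (simp only: mult.assoc)
  finally show ?thesis
    by simp
qed

text \<open>Testing the convolution against \<open>exp (- t)\<close> determines the constant, which avoids the
  complex Beta integral.\<close>

lemma frac_kernel_convolution:
  fixes F :: "real \<Rightarrow> complex"
  assumes a: "Re a > 0" and b: "Re b > 0" and F: "F \<in> borel_measurable borel"
    and C: "\<And>t. t > 0 \<Longrightarrow> norm (F t) \<le> C * exp (- t)"
  shows "(LINT r|lborel. frac_kernel a r * (LINT s|lborel. frac_kernel b s * F (r + s)))
    = (LINT t|lborel. frac_kernel (a + b) t * F t)"
proof -
  have E: "(LINT x|lborel. frac_kernel a x * exp (- of_real x)) = 1" if "Re a > 0" for a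
    using has_bochner_integral_frac_kernel_exp[OF that] by (simp add: has_bochner_integral_iff)
  have "(LINT r|lborel. frac_kernel a r * (LINT s|lborel. frac_kernel b s * exp (- of_real (r + s))))
      = (LINT r|lborel. frac_kernel a r * exp (- of_real r) * (LINT s|lborel. frac_kernel b s * exp (- of_real s)))"
  proof (rule Bochner_Integration.integral_cong[OF refl])
    fix r :: real
    have "(\<lambda>s. frac_kernel b s * exp (- of_real (r + s)))
        = (\<lambda>s. exp (- of_real r) * (frac_kernel b s * exp (- of_real s)))"
      by (simp add: exp_add exp_diff exp_minus divide_inverse mult_ac)
    then show "frac_kernel a r * (LINT s|lborel. frac_kernel b s * exp (- of_real (r + s)))
        = frac_kernel a r * exp (- of_real r) * (LINT s|lborel. frac_kernel b s * exp (- of_real s))"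
      by (simp add: mult.assoc)
  qed
  also have "\<dots> = 1"
    using E[OF a] E[OF b] by simp
  finally have "(LINT x|lborel. frac_kernel a x * frac_kernel b (1 - x)) * Gamma (a + b) * 1 = 1"
    using frac_kernel_convolution_const[OF a b, of "\<lambda>t. exp (- of_real t)" 1] E[of "a + b"] a b
    by simp
  then show ?thesis
    using frac_kernel_convolution_const[OF a b F C] by simp
qed


section \<open>Fractional derivatives in one variable\<close>

lemma Re_less_frac_index: "Re s < real (frac_index s)"
  unfolding frac_index_def by (rule LeastI_ex) (rule reals_Archimedean2)

lemma funpow_dist_deriv: "(dist_deriv b ^^ n) T \<phi> = (- 1) ^ n * T ((dirderiv b ^^ n) \<phi>)"
proof (induction n arbitrary: \<phi>)
  case (Suc n)
  then show ?case
    by (simp add: dist_deriv_def funpow_swap1[of "dirderiv b"])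
qed simp

text \<open>Its order has positive real part, so it is locally integrable;
  \<open>frac_delta s\<close> is its distributional derivative of order
  \<open>frac_index s\<close>.\<close>

abbreviation frac_weight :: "complex \<Rightarrow> real \<Rightarrow> complex" where
  "frac_weight s \<equiv> frac_kernel (of_nat (frac_index s) - s)"

lemma loc_integrable_frac_weight: "loc_integrable (frac_weight s)"
  using Re_less_frac_index[of s] by (intro loc_integrable_frac_kernel) simp

lemma frac_delta_eq:
  "frac_delta s f = (- 1) ^ frac_index s
    * (LINT r|lborel. frac_weight s r * (dirderiv 1 ^^ frac_index s) f r)"
  by (simp add: frac_delta_def Let_def funpow_dist_deriv regular_def)

lemma frac_transpose_eq:
  "frac_transpose b s \<phi> p = (- 1) ^ frac_index s
    * (LINT r|lborel. frac_weight s r * (dirderiv b ^^ frac_index s) \<phi> (p + r *\<^sub>R b))"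
  by (simp add: frac_transpose_def Let_def)

text \<open>Derivatives of a section in r are directional derivatives of \<open>\<phi>\<close>.
  Hence convolution with \<open>frac_delta s\<close> and the transposed differintegral are the same
  operation on test functions.\<close>

lemma frac_delta_section:
  assumes "test_function \<phi>" "b \<in> Basis"
  shows "frac_delta s (\<lambda>r. \<phi> (p + r *\<^sub>R b)) = frac_transpose b s \<phi> p"
  by (simp add: frac_delta_eq frac_transpose_eq funpow_dirderiv_section[OF assms])

lemma frac_transpose_section:
  assumes "test_function \<phi>" "b \<in> Basis"
  shows "frac_transpose b s \<phi> (p + v *\<^sub>R b) = frac_transpose 1 s (\<lambda>r. \<phi> (p + r *\<^sub>R b)) v"
  by (simp add: frac_transpose_eq funpow_dirderiv_section[OF assms] scaleR_add_left add.assoc)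

text \<open>By \<open>frac_delta_section\<close> the two defining sequences coincide term by term,
  not merely in the limit.\<close>

theorem has_frac_deriv_iff_has_convolution:
  assumes "b \<in> Basis"
  shows "has_frac_deriv b s T R \<longleftrightarrow> has_convolution b T (frac_delta s) R"
  unfolding has_frac_deriv_def has_convolution_def
  by (simp add: frac_delta_section[OF _ assms] cong: conj_cong imp_cong)

text \<open>The index law tested at the origin. Agreement on v > - 1 suffices for
  \<open>\<psi>\<close>, since this open half-line contains the support of the kernel and agreement
  on an open set carries over to derivatives. This leaves room for the cut-offs.\<close>

lemma frac_delta_frac_transpose:
  fixes f :: "real \<Rightarrow> complex"
  assumes f: "test_function f" and \<psi>: "\<And>v. v > - 1 \<Longrightarrow> \<psi> v = frac_transpose 1 s f v"
  shows "frac_delta (- s) \<psi> = f 0"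
proof -
  define n m where "n = frac_index s" and "m = frac_index (- s)"
  have n: "Re (of_nat n - s) > 0" and m: "Re (of_nat m + s) > 0"
    using Re_less_frac_index[of s] Re_less_frac_index[of "- s"] by (simp_all add: n_def m_def)
  \<comment> \<open>The two kernel orders have positive real parts, and s cancels in their sum m +
    n.\<close>
  have "real m + real n > 0"
    using n m by simp
  then have nm: "m + n > 0"
    by linarith
  define g where "g x = (- 1) ^ n * (dirderiv 1 ^^ n) f x" for x
  have fn: "test_function ((dirderiv 1 ^^ n) f)"
    by (intro test_function_funpow_dirderiv f) simp
  then have g: "test_function g"
    unfolding g_def by (rule test_function_scale)
  then have gm: "test_function ((dirderiv 1 ^^ m) g)"
    by (intro test_function_funpow_dirderiv) simp_all
  have D: "(dirderiv 1 ^^ m) g x = (- 1) ^ n * (dirderiv 1 ^^ (m + n)) f x" for x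
    unfolding g_def using funpow_dirderiv_scale[OF fn, of 1 m] by (simp add: funpow_add)
  obtain R where R: "\<And>x. norm x > R \<Longrightarrow> (dirderiv 1 ^^ m) g x = 0"
    using test_functionE[OF gm] by metis
  obtain C where C: "C > 0" "\<And>x. norm ((dirderiv 1 ^^ m) g x) \<le> C"
    using test_function_bounded[OF gm] by metis
  \<comment> \<open>Beyond R the function is 0; for t \<le> R the factor exp (R - t) is at least
    1.\<close>
  have decay: "norm ((dirderiv 1 ^^ m) g t) \<le> (C * exp R) * exp (- t)" if "t > 0" for t
  proof (cases "t > R")
    case False
    then have "C * 1 \<le> C * (exp R * exp (- t))"
      using C(1) by (intro mult_left_mono) (auto simp: exp_add[symmetric])
    with C(2)[of t] show ?thesis
      by (simp add: mult.assoc)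
  qed (use that R C(1) in simp)
  have eq: "frac_kernel (of_nat m + s) x * (dirderiv 1 ^^ m) \<psi> x = frac_kernel (of_nat m + s) x
      * (LINT r|lborel. frac_kernel (of_nat n - s) r * (dirderiv 1 ^^ m) g (x + r))" for x
  proof (cases "x > 0")
    case True
    have "(dirderiv 1 ^^ m) \<psi> x
        = (dirderiv 1 ^^ m) (\<lambda>v. LINT r|lborel. frac_kernel (of_nat n - s) r * g (v + r)) x"
      by (rule funpow_dirderiv_cong_open[of "{- 1<..}"])
        (use True in \<open>auto simp: \<psi> frac_transpose_eq g_def n_def mult.left_commute\<close>)
    then show ?thesis
      by (simp add: funpow_dirderiv_weighted_translate[OF g loc_integrable_frac_kernel[OF n]])
  qed (simp add: frac_kernel_nonpos)
  have "frac_delta (- s) \<psi> = (- 1) ^ m * (LINT x|lborel. frac_kernel (of_nat m + s) x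
      * (LINT r|lborel. frac_kernel (of_nat n - s) r * (dirderiv 1 ^^ m) g (x + r)))"
    by (simp add: frac_delta_eq m_def[symmetric] eq)
  also have "\<dots> = (- 1) ^ m
      * (LINT t|lborel. frac_kernel (of_nat m + s + (of_nat n - s)) t * (dirderiv 1 ^^ m) g t)"
    by (subst frac_kernel_convolution[OF m n test_function_measurable[OF gm] decay]) simp_all
  also have "\<dots> = (- 1) ^ (m + n) * (LINT t|lborel. frac_kernel (of_nat (m + n)) t * (dirderiv 1 ^^ (m + n)) f t)"
    by (simp add: D mult.left_commute[of _ "(- 1) ^ n"] power_add)
  \<comment> \<open>Integrating by parts produces the sign (-1)^(m + n) a second time, and the two
    signs cancel.\<close>
  also have "\<dots> = f 0"
    by (simp only: frac_kernel_of_nat_integral[OF f nm] left_minus_one_mult_self)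
  finally show ?thesis .
qed

text \<open>With n = \<open>frac_index (- a)\<close>, moving all n derivatives back onto the kernel
  lowers its order from a + n to a; the two signs (-1)^n cancel.\<close>

lemma frac_delta_eq_frac_kernel:
  assumes f: "test_function f" and a: "Re a > 0 \<or> (\<exists>\<epsilon>>0. \<forall>x. \<bar>x\<bar> < \<epsilon> \<longrightarrow> f x = 0)"
  shows "frac_delta (- a) f = (LINT x|lborel. frac_kernel a x * f x)"
  using frac_kernel_funpow_parts[OF f a, of "frac_index (- a)"]
  by (simp add: frac_delta_eq add.commute mult.assoc[symmetric] power_add[symmetric] mult_2[symmetric])


section \<open>Tensor products of fractional deltas\<close>

lemma frac_delta_add_scale:
  assumes "test_function f" "test_function g"
  shows "frac_delta s (\<lambda>x. f x + c * g x) = frac_delta s f + c * frac_delta s g"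
proof -
  let ?D = "dirderiv 1 ^^ frac_index s"
  have "integrable lborel (\<lambda>r. frac_weight s r * ?D f r)" "integrable lborel (\<lambda>r. frac_weight s r * ?D g r)"
    using assms by (auto intro!: integrable_loc_integrable_test_function loc_integrable_frac_weight
        test_function_funpow_dirderiv)
  then have "(LINT r|lborel. frac_weight s r * (?D f r + c * ?D g r))
      = (LINT r|lborel. frac_weight s r * ?D f r) + c * (LINT r|lborel. frac_weight s r * ?D g r)"
    by (simp add: distrib_left mult.left_commute[of _ c])
  then show ?thesis
    using funpow_dirderiv_add_scale[OF assms, of 1] by (simp add: frac_delta_eq algebra_simps)
qed

lemma frac_delta_snd:
  fixes \<phi> :: "real \<times> real \<Rightarrow> complex"
  assumes "test_function \<phi>"
  shows "frac_delta s (\<lambda>v. \<phi> (u, v)) = (- 1) ^ frac_index s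
    * (LINT v|lborel. frac_weight s v * (dirderiv v_dir ^^ frac_index s) \<phi> (u, v))"
  using frac_delta_section[OF assms v_dir_Basis, of s "(u, 0)"]
  by (simp add: frac_transpose_eq v_dir_def)

text \<open>Lets a second functional act in u, as \<open>tensor\<close> requires; differentiation in
  u passes under the integral in v.\<close>

lemma test_function_frac_delta:
  fixes \<phi> :: "real \<times> real \<Rightarrow> complex"
  assumes "test_function \<phi>"
  shows "test_function (\<lambda>u. frac_delta s (\<lambda>v. \<phi> (u, v)))"
  unfolding frac_delta_snd[OF assms]
  by (intro test_function_scale test_function_weighted_integral test_function_funpow_dirderiv
      assms v_dir_Basis loc_integrable_frac_weight)

section \<open>Seminorm estimates: the tensor products are distributions\<close>

text \<open>All derivatives are gathered on \<open>\<phi>\<close>, so that the seminorm estimate can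
  be read off an iterated integral with locally integrable weights.\<close>

lemma tensor_frac_delta_eq:
  assumes \<phi>: "test_function \<phi>"
  shows "tensor (frac_delta a) (frac_delta b) \<phi> = (- 1) ^ (frac_index a + frac_index b)
    * (LINT u|lborel. frac_weight a u * (LINT v|lborel. frac_weight b v
        * ((dirderiv u_dir ^^ frac_index a) ((dirderiv v_dir ^^ frac_index b) \<phi>)) (u, v)))"
proof -
  define m n \<psi> where "m = frac_index a" and "n = frac_index b" and "\<psi> = (dirderiv v_dir ^^ n) \<phi>"
  have \<psi>: "test_function \<psi>"
    unfolding \<psi>_def by (rule test_function_funpow_dirderiv[OF \<phi> v_dir_Basis])
  have "test_function (\<lambda>u. LINT v|lborel. frac_weight b v * \<psi> (u, v))"
    by (rule test_function_weighted_integral[OF \<psi> loc_integrable_frac_weight])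
  from funpow_dirderiv_scale[OF this, of 1 m "(- 1) ^ n"]
  have "(dirderiv 1 ^^ m) (\<lambda>u. (- 1) ^ n * (LINT v|lborel. frac_weight b v * \<psi> (u, v)))
      = (\<lambda>u. (- 1) ^ n * (LINT v|lborel. frac_weight b v * (dirderiv u_dir ^^ m) \<psi> (u, v)))"
    by (simp add: funpow_dirderiv_weighted_integral[OF \<psi> loc_integrable_frac_weight])
  then have "tensor (frac_delta a) (frac_delta b) \<phi> = (- 1) ^ m * (LINT u|lborel. frac_weight a u
      * ((- 1) ^ n * (LINT v|lborel. frac_weight b v * (dirderiv u_dir ^^ m) \<psi> (u, v))))"
    by (simp add: tensor_def frac_delta_snd[OF \<phi>] frac_delta_eq[of a] m_def n_def \<psi>_def)
  also have "\<dots> = (- 1) ^ (m + n) * (LINT u|lborel. frac_weight a u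
      * (LINT v|lborel. frac_weight b v * (dirderiv u_dir ^^ m) \<psi> (u, v)))"
    by (simp only: mult.left_commute[of "frac_weight a _" "(- 1) ^ n"] integral_mult_right_zero power_add mult.assoc)
  finally show ?thesis
    by (simp only: m_def n_def \<psi>_def)
qed

lemma norm_weighted_integral_le:
  assumes w: "loc_integrable w" and F: "\<And>x. norm (F x) \<le> B" and R: "\<And>x. \<bar>x\<bar> > R \<Longrightarrow> F x = 0"
  shows "norm (LINT x|lborel. w x * F x) \<le> (LINT x|lborel. norm (indicator {-R..R} x *\<^sub>R w x)) * B"
proof (cases "integrable lborel (\<lambda>x. w x * F x)")
  case True
  have int: "integrable lborel (\<lambda>x. norm (indicator {-R..R} x *\<^sub>R w x))"
    using w by (intro integrable_norm) (auto simp: loc_integrable_def set_integrable_def)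
  have "norm (LINT x|lborel. w x * F x) \<le> (LINT x|lborel. norm (indicator {-R..R} x *\<^sub>R w x) * B)"
  proof (rule Bochner_Integration.integral_norm_bound_integral[OF True])
    show "integrable lborel (\<lambda>x. norm (indicator {-R..R} x *\<^sub>R w x) * B)"
      using int by (rule integrable_mult_left)
    show "norm (w x * F x) \<le> norm (indicator {-R..R} x *\<^sub>R w x) * B" for x
      using R[of x] F[of x] by (cases "\<bar>x\<bar> > R") (auto simp: norm_mult indicator_def mult_left_mono)
  qed
  then show ?thesis
    by simp
next
  case False
  \<comment> \<open>In this case the integral is 0 by convention, so the bound only has to be
    nonnegative.\<close>
  have "0 \<le> B"
    using F[of 0] norm_ge_zero order_trans by blast
  then show ?thesis
    using False by (simp add: not_integrable_integral_eq)
qed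

lemma foldr_replicate_dirderiv: "foldr dirderiv (replicate n b) \<phi> = (dirderiv b ^^ n) \<phi>"
  by (induction n) auto

text \<open>Every compact set lies in a ball, so estimates for functions supported in balls are
  enough.\<close>

lemma distributionI:
  assumes linear: "\<And>f g c. test_function f \<Longrightarrow> test_function g \<Longrightarrow>
      T (\<lambda>x. f x + c * g x) = T f + c * T g"
    and bound: "\<And>R. \<exists>C N. \<forall>\<phi> M. test_function \<phi> \<longrightarrow> (\<forall>x. norm x > R \<longrightarrow> \<phi> x = 0) \<longrightarrow>
      (\<forall>bs. set bs \<subseteq> Basis \<longrightarrow> length bs \<le> N \<longrightarrow> (\<forall>x. norm (foldr dirderiv bs \<phi> x) \<le> M)) \<longrightarrow>
      norm (T \<phi>) \<le> C * M"
  shows "distribution T"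
proof -
  have T0: "T (\<lambda>_. 0) = 0"
    using linear[OF test_function_zero test_function_zero, of 1] by simp
  have "T (\<lambda>x. c * f x) = c * T f" if "test_function f" for c f
    using linear[OF test_function_zero that, of c] T0 by simp
  moreover have "T (\<lambda>x. f x + g x) = T f + T g" if "test_function f" "test_function g" for f g
    using linear[OF that, of 1] by simp
  moreover have "\<exists>C N. \<forall>\<phi> M. test_function \<phi> \<longrightarrow> tsupport \<phi> \<subseteq> K \<longrightarrow>
      (\<forall>bs. set bs \<subseteq> Basis \<longrightarrow> length bs \<le> N \<longrightarrow> (\<forall>x. norm (foldr dirderiv bs \<phi> x) \<le> M)) \<longrightarrow>
      norm (T \<phi>) \<le> C * M" if K: "compact K" for K
  proof -
    obtain R where R: "\<And>x. x \<in> K \<Longrightarrow> norm x \<le> R"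
      using compact_imp_bounded[OF K] by (auto simp: bounded_iff)
    have "\<phi> x = 0" if "tsupport \<phi> \<subseteq> K" "norm x > R" for \<phi> :: "'a \<Rightarrow> complex" and x
    proof (rule ccontr)
      assume "\<phi> x \<noteq> 0"
      then have "x \<in> K"
        using that closure_subset[of "{x. \<phi> x \<noteq> 0}"] by (auto simp: tsupport_def)
      then show False
        using R[of x] that by simp
    qed
    then show ?thesis
      using bound[of R] by meson
  qed
  ultimately show ?thesis
    unfolding distribution_def by blast
qed

lemma distribution_scale:
  assumes "distribution T"
  shows "distribution (\<lambda>\<phi>. k * T \<phi>)"
  unfolding distribution_def
proof (intro conjI allI impI)
  fix K :: "'a set" assume "compact K"
  then obtain C N where C: "\<forall>\<phi> M. test_function \<phi> \<longrightarrow> tsupport \<phi> \<subseteq> K \<longrightarrow>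
      (\<forall>bs. set bs \<subseteq> Basis \<longrightarrow> length bs \<le> N \<longrightarrow> (\<forall>x. norm (foldr dirderiv bs \<phi> x) \<le> M)) \<longrightarrow>
      norm (T \<phi>) \<le> C * M"
    using assms unfolding distribution_def by meson
  show "\<exists>C N. \<forall>\<phi> M. test_function \<phi> \<longrightarrow> tsupport \<phi> \<subseteq> K \<longrightarrow>
      (\<forall>bs. set bs \<subseteq> Basis \<longrightarrow> length bs \<le> N \<longrightarrow> (\<forall>x. norm (foldr dirderiv bs \<phi> x) \<le> M)) \<longrightarrow>
      norm (k * T \<phi>) \<le> C * M"
  proof (intro exI[of _ "norm k * C"] exI[of _ N] allI impI)
    fix \<phi> M
    assume "test_function \<phi>" "tsupport \<phi> \<subseteq> K"
      "\<forall>bs. set bs \<subseteq> Basis \<longrightarrow> length bs \<le> N \<longrightarrow> (\<forall>x. norm (foldr dirderiv bs \<phi> x) \<le> M)"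
    then have "norm (T \<phi>) \<le> C * M"
      using C by blast
    then show "norm (k * T \<phi>) \<le> norm k * C * M"
      by (simp add: norm_mult mult.assoc mult_left_mono)
  qed
qed (use assms in \<open>auto simp: distribution_def distrib_left\<close>)

lemma distribution_tensor_frac_delta: "distribution (tensor (frac_delta a) (frac_delta b))"
proof (rule distributionI)
  fix f g :: "real \<times> real \<Rightarrow> complex" and c
  assume *: "test_function f" "test_function g"
  show "tensor (frac_delta a) (frac_delta b) (\<lambda>x. f x + c * g x)
      = tensor (frac_delta a) (frac_delta b) f + c * tensor (frac_delta a) (frac_delta b) g"
    unfolding tensor_def
    by (simp add: frac_delta_add_scale test_function_curry_snd test_function_frac_delta *)
next
  fix R :: real
  define m n where "m = frac_index a" and "n = frac_index b"
  define A B where "A = (LINT x|lborel. norm (indicator {-R..R} x *\<^sub>R frac_weight a x))"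
    and "B = (LINT x|lborel. norm (indicator {-R..R} x *\<^sub>R frac_weight b x))"
  have "norm (tensor (frac_delta a) (frac_delta b) \<phi>) \<le> A * B * M"
    if \<phi>: "test_function \<phi>" and R: "\<forall>x. norm x > R \<longrightarrow> \<phi> x = 0"
      and M: "\<forall>bs. set bs \<subseteq> Basis \<longrightarrow> length bs \<le> m + n \<longrightarrow> (\<forall>x. norm (foldr dirderiv bs \<phi> x) \<le> M)"
    for \<phi> M
  proof -
    define G where "G = (dirderiv u_dir ^^ m) ((dirderiv v_dir ^^ n) \<phi>)"
    have R1: "norm x > R \<Longrightarrow> (dirderiv v_dir ^^ n) \<phi> x = 0" for x
      using R by (intro funpow_dirderiv_eq_0_outside[of R \<phi>]) auto
    have GR: "norm x > R \<Longrightarrow> G x = 0" for x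
      unfolding G_def by (rule funpow_dirderiv_eq_0_outside[OF R1])
    \<comment> \<open>The mixed derivative is spelled as a list of m + n basis vectors, the form in
      which \<open>M\<close> bounds derivatives.\<close>
    have "G = foldr dirderiv (replicate m u_dir @ replicate n v_dir) \<phi>"
      by (simp add: G_def foldr_replicate_dirderiv)
    then have GM: "norm (G x) \<le> M" for x
      using M[rule_format, of "replicate m u_dir @ replicate n v_dir" x] u_dir_Basis v_dir_Basis
      by (auto simp: set_replicate_conv_if split: if_splits)
    have "norm (LINT u|lborel. frac_weight a u * (LINT v|lborel. frac_weight b v * G (u, v))) \<le> A * (B * M)"
      unfolding A_def
    proof (rule norm_weighted_integral_le[OF loc_integrable_frac_weight])
      fix u :: real
      show "norm (LINT v|lborel. frac_weight b v * G (u, v)) \<le> B * M"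
        unfolding B_def
      proof (rule norm_weighted_integral_le[OF loc_integrable_frac_weight GM])
        show "G (u, v) = 0" if "\<bar>v\<bar> > R" for v
          using that norm_snd_le[of v u] by (intro GR) simp
      qed
      show "(LINT v|lborel. frac_weight b v * G (u, v)) = 0" if "\<bar>u\<bar> > R"
      proof -
        have "G (u, v) = 0" for v
          using that norm_fst_le[of u v] by (intro GR) simp
        then show ?thesis
          by simp
      qed
    qed
    then show ?thesis
      by (simp add: tensor_frac_delta_eq[OF \<phi>] norm_mult norm_power G_def m_def n_def mult.assoc)
  qed
  then show "\<exists>C N. \<forall>\<phi> M. test_function \<phi> \<longrightarrow> (\<forall>x. norm x > R \<longrightarrow> \<phi> x = 0) \<longrightarrow>
      (\<forall>bs. set bs \<subseteq> Basis \<longrightarrow> length bs \<le> N \<longrightarrow> (\<forall>x. norm (foldr dirderiv bs \<phi> x) \<le> M)) \<longrightarrow>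
      norm (tensor (frac_delta a) (frac_delta b) \<phi>) \<le> C * M"
    by blast
qed

lemma tensor_dirac_eq: "tensor S dirac \<phi> = S (\<lambda>u. \<phi> (u, 0))"
  by (simp add: tensor_def dirac_def)

text \<open>\<open>has_frac_deriv\<close> demands a distribution as its result. This covers the
  intermediate stage, with the derivative in v taken and the one in u still to come.\<close>

lemma distribution_tensor_frac_delta_dirac: "distribution (tensor (frac_delta a) dirac)"
proof (rule distributionI)
  fix f g :: "real \<times> real \<Rightarrow> complex" and c
  assume "test_function f" "test_function g"
  then show "tensor (frac_delta a) dirac (\<lambda>x. f x + c * g x)
      = tensor (frac_delta a) dirac f + c * tensor (frac_delta a) dirac g"
    by (simp add: tensor_dirac_eq frac_delta_add_scale test_function_curry_fst)
next
  fix R :: real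
  define m where "m = frac_index a"
  define A where "A = (LINT x|lborel. norm (indicator {-R..R} x *\<^sub>R frac_weight a x))"
  have "norm (tensor (frac_delta a) dirac \<phi>) \<le> A * M"
    if \<phi>: "test_function \<phi>" and R: "\<forall>x. norm x > R \<longrightarrow> \<phi> x = 0"
      and M: "\<forall>bs. set bs \<subseteq> Basis \<longrightarrow> length bs \<le> m \<longrightarrow> (\<forall>x. norm (foldr dirderiv bs \<phi> x) \<le> M)"
    for \<phi> M
  proof -
    have eq: "tensor (frac_delta a) dirac \<phi>
        = (- 1) ^ m * (LINT u|lborel. frac_weight a u * (dirderiv u_dir ^^ m) \<phi> (u, 0))"
      using frac_delta_section[OF \<phi> u_dir_Basis, of a "(0, 0)"]
      by (simp add: tensor_dirac_eq frac_transpose_eq m_def u_dir_def)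
    have "norm (LINT u|lborel. frac_weight a u * (dirderiv u_dir ^^ m) \<phi> (u, 0)) \<le> A * M"
      unfolding A_def
    proof (rule norm_weighted_integral_le[OF loc_integrable_frac_weight])
      fix u :: real
      show "norm ((dirderiv u_dir ^^ m) \<phi> (u, 0)) \<le> M"
        using M[rule_format, of "replicate m u_dir" "(u, 0)"] u_dir_Basis
        by (auto simp: foldr_replicate_dirderiv set_replicate_conv_if split: if_splits)
      show "(dirderiv u_dir ^^ m) \<phi> (u, 0) = 0" if "\<bar>u\<bar> > R"
        using that R norm_fst_le[of u 0] by (intro funpow_dirderiv_eq_0_outside[of R \<phi>]) auto
    qed
    then show ?thesis
      by (simp add: eq norm_mult norm_power)
  qed
  then show "\<exists>C N. \<forall>\<phi> M. test_function \<phi> \<longrightarrow> (\<forall>x. norm x > R \<longrightarrow> \<phi> x = 0) \<longrightarrow>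
      (\<forall>bs. set bs \<subseteq> Basis \<longrightarrow> length bs \<le> N \<longrightarrow> (\<forall>x. norm (foldr dirderiv bs \<phi> x) \<le> M)) \<longrightarrow>
      norm (tensor (frac_delta a) dirac \<phi>) \<le> C * M"
    by blast
qed

lemma distribution_delta_uv: "distribution delta_uv"
  unfolding delta_uv_def[abs_def]
proof (intro distribution_scale distributionI exI allI impI)
  fix R M :: real and \<phi> :: "real \<times> real \<Rightarrow> complex"
  assume "\<forall>bs. set bs \<subseteq> Basis \<longrightarrow> length bs \<le> 0 \<longrightarrow> (\<forall>x. norm (foldr dirderiv bs \<phi> x) \<le> M)"
  then show "norm (tensor dirac dirac \<phi>) \<le> 1 * M"
    by (auto simp: tensor_def dirac_def)
qed (simp add: tensor_def dirac_def)


section \<open>The fundamental solution\<close>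

text \<open>The kernel vanishes for r \<le> 0, so the transposed derivative at v sees only values of
  \<open>f\<close> and its derivatives to the right of v.\<close>

lemma frac_transpose_eq_0:
  assumes "\<And>x. norm x > R \<Longrightarrow> f x = 0" "v > R"
  shows "frac_transpose 1 s f v = 0"
proof -
  have "frac_weight s r * (dirderiv 1 ^^ frac_index s) f (v + r) = 0" for r
  proof (cases "r \<le> 0")
    case False
    then have "norm (v + r) > R"
      using assms(2) by auto
    then show ?thesis
      using funpow_dirderiv_eq_0_outside[of R f "v + r"] assms(1) by simp
  qed (simp add: frac_kernel_nonpos)
  then show ?thesis
    by (simp only: frac_transpose_eq real_scaleR_def mult_1_right Bochner_Integration.integral_zero mult_zero_right)
qed

text \<open>On [- 1, R] the cut-off is 1, and beyond R the transposed derivative is already 0. The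
  product therefore agrees with the transposed derivative for all v > - 1.\<close>

lemma frac_delta_cutoff:
  assumes "test_function f" "\<And>x. norm x > R \<Longrightarrow> f x = 0" "\<And>x. x \<in> {- 1..R} \<Longrightarrow> \<eta> x = 1"
  shows "frac_delta (- s) (\<lambda>v. \<eta> v * frac_transpose 1 s f v) = f 0"
proof (rule frac_delta_frac_transpose[OF assms(1)])
  fix v :: real assume "v > - 1"
  then show "\<eta> v * frac_transpose 1 s f v = frac_transpose 1 s f v"
    using assms(3)[of v] frac_transpose_eq_0[of R f v s] assms(2) by (cases "v > R") auto
qed

lemma inner_u_dir [simp]: "p \<bullet> u_dir = fst p"
  and inner_v_dir [simp]: "p \<bullet> v_dir = snd p"
  by (simp_all add: u_dir_def v_dir_def inner_prod_def)

lemma frac_transpose_v_dir: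
  assumes "test_function \<phi>"
  shows "frac_transpose v_dir s \<phi> (u, v) = frac_transpose 1 s (\<lambda>v. \<phi> (u, v)) v"
  using frac_transpose_section[OF assms v_dir_Basis, of s "(u, 0)" v] by (simp add: v_dir_def)

lemma frac_transpose_u_dir:
  assumes "test_function \<phi>"
  shows "frac_transpose u_dir s \<phi> (u, v) = frac_transpose 1 s (\<lambda>u. \<phi> (u, v)) u"
  using frac_transpose_section[OF assms u_dir_Basis, of s "(0, v)" u] by (simp add: u_dir_def)

lemma unit_sequence_eventually:
  assumes "unit_sequence \<eta>"
  shows "\<forall>\<^sub>F k in sequentially. \<forall>x\<in>{a..b}. \<eta> k x = 1"
  using assms by (simp add: unit_sequence_def)

text \<open>The radius R is taken in the plane, so a cut-off equal to 1 on [- 1, R] gives the exact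
  value for every u at once, and the defining sequence is eventually constant.\<close>

lemma has_frac_deriv_v_dir_tensor:
  "has_frac_deriv v_dir a (\<lambda>\<phi>. k * tensor (frac_delta c) (frac_delta (- a)) \<phi>) (\<lambda>\<phi>. k * tensor (frac_delta c) dirac \<phi>)"
  unfolding has_frac_deriv_def
proof (intro conjI allI impI)
  fix \<phi> :: "real \<times> real \<Rightarrow> complex" and \<eta>
  assume \<phi>: "test_function \<phi>" and \<eta>: "unit_sequence \<eta>"
  obtain R where R: "\<And>x. norm x > R \<Longrightarrow> \<phi> x = 0"
    using test_functionE[OF \<phi>] by metis
  have \<phi>R: "\<phi> (u, v) = 0" if "norm v > R" for u v
    using that norm_snd_le[of v u] by (intro R) simp
  have cutoff: "frac_delta (- a) (\<lambda>v. \<eta> k v * frac_transpose v_dir a \<phi> (u, v)) = \<phi> (u, 0)"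
    if "\<forall>x\<in>{- 1..R}. \<eta> k x = 1" for k u
    unfolding frac_transpose_v_dir[OF \<phi>]
    using that by (intro frac_delta_cutoff[of _ R] test_function_curry_snd \<phi>) (auto simp: \<phi>R)
  have "\<forall>\<^sub>F k' in sequentially. k * tensor (frac_delta c) (frac_delta (- a))
      (\<lambda>p. \<eta> k' (p \<bullet> v_dir) * frac_transpose v_dir a \<phi> p) = k * tensor (frac_delta c) dirac \<phi>"
    using unit_sequence_eventually[OF \<eta>, of "- 1" R]
    by (rule eventually_mono) (simp add: tensor_def dirac_def cutoff)
  then show "(\<lambda>k'. k * tensor (frac_delta c) (frac_delta (- a))
      (\<lambda>p. \<eta> k' (p \<bullet> v_dir) * frac_transpose v_dir a \<phi> p)) \<longlonglongrightarrow> k * tensor (frac_delta c) dirac \<phi>"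
    by (rule tendsto_eventually)
qed (intro distribution_scale distribution_tensor_frac_delta_dirac)

lemma has_frac_deriv_u_dir_tensor:
  "has_frac_deriv u_dir b (\<lambda>\<phi>. 1 / 2 * tensor (frac_delta (- b)) dirac \<phi>) delta_uv"
  unfolding has_frac_deriv_def
proof (intro conjI allI impI)
  fix \<phi> :: "real \<times> real \<Rightarrow> complex" and \<eta>
  assume \<phi>: "test_function \<phi>" and \<eta>: "unit_sequence \<eta>"
  obtain R where R: "\<And>x. norm x > R \<Longrightarrow> \<phi> x = 0"
    using test_functionE[OF \<phi>] by metis
  have \<phi>R: "\<phi> (u, 0) = 0" if "norm u > R" for u
    using that norm_fst_le[of u 0] by (intro R) simp
  have cutoff: "frac_delta (- b) (\<lambda>u. \<eta> k u * frac_transpose u_dir b \<phi> (u, 0)) = \<phi> (0, 0)"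
    if "\<forall>x\<in>{- 1..R}. \<eta> k x = 1" for k
    unfolding frac_transpose_u_dir[OF \<phi>]
    using that by (intro frac_delta_cutoff[of _ R] test_function_curry_fst \<phi>) (auto simp: \<phi>R)
  have "\<forall>\<^sub>F k in sequentially. 1 / 2 * tensor (frac_delta (- b)) dirac
      (\<lambda>p. \<eta> k (p \<bullet> u_dir) * frac_transpose u_dir b \<phi> p) = delta_uv \<phi>"
    using unit_sequence_eventually[OF \<eta>, of "- 1" R]
    by (rule eventually_mono) (simp add: tensor_def dirac_def delta_uv_def cutoff)
  then show "(\<lambda>k. 1 / 2 * tensor (frac_delta (- b)) dirac
      (\<lambda>p. \<eta> k (p \<bullet> u_dir) * frac_transpose u_dir b \<phi> p)) \<longlonglongrightarrow> delta_uv \<phi>"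
    by (rule tendsto_eventually)
qed (rule distribution_delta_uv)

section \<open>The fundamental solution as a function\<close>

lemma has_bochner_integral_tensor_frac_delta:
  assumes \<phi>: "test_function \<phi>"
    and b: "Re b > 0 \<or> (\<exists>\<epsilon>>0. \<forall>p. \<phi> p \<noteq> 0 \<longrightarrow> \<epsilon> \<le> \<bar>fst p\<bar>)"
    and a: "Re a > 0 \<or> (\<exists>\<epsilon>>0. \<forall>p. \<phi> p \<noteq> 0 \<longrightarrow> \<epsilon> \<le> \<bar>snd p\<bar>)"
  shows "has_bochner_integral lborel (\<lambda>(u, v). frac_kernel b u * (frac_kernel a v * \<phi> (u, v)))
    (tensor (frac_delta (- b)) (frac_delta (- a)) \<phi>)"
proof -
  have inner: "frac_delta (- a) (\<lambda>v. \<phi> (u, v)) = (LINT v|lborel. frac_kernel a v * \<phi> (u, v))" for u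
    using a by (intro frac_delta_eq_frac_kernel test_function_curry_snd \<phi>) force
  have "tensor (frac_delta (- b)) (frac_delta (- a)) \<phi>
      = (LINT u|lborel. frac_kernel b u * frac_delta (- a) (\<lambda>v. \<phi> (u, v)))"
    unfolding tensor_def
  proof (intro frac_delta_eq_frac_kernel test_function_frac_delta \<phi>)
    show "0 < Re b \<or> (\<exists>\<epsilon>>0. \<forall>u. \<bar>u\<bar> < \<epsilon> \<longrightarrow> frac_delta (- a) (\<lambda>v. \<phi> (u, v)) = 0)"
      using b
    proof (elim disjE exE conjE)
      fix \<epsilon> :: real assume \<epsilon>: "\<epsilon> > 0" "\<forall>p. \<phi> p \<noteq> 0 \<longrightarrow> \<epsilon> \<le> \<bar>fst p\<bar>"
      then have "\<phi> (u, v) = 0" if "\<bar>u\<bar> < \<epsilon>" for u v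
        using that by force
      then show ?thesis
        using \<epsilon>(1) by (auto simp: inner)
    qed simp
  qed
  then have eq: "tensor (frac_delta (- b)) (frac_delta (- a)) \<phi>
      = (LINT u|lborel. LINT v|lborel. frac_kernel b u * (frac_kernel a v * \<phi> (u, v)))"
    by (simp add: inner)
  \<comment> \<open>Locally integrable weights replace the kernels on the projections of the set
    where \<open>\<phi>\<close> is nonzero. This yields integrability over the plane, so Fubini
    identifies the iterated integral.\<close>
  obtain w1 where w1: "loc_integrable w1" "\<And>u. u \<in> fst ` {p. \<phi> p \<noteq> 0} \<Longrightarrow> w1 u = frac_kernel b u"
    using frac_kernel_weight[of b "fst ` {p. \<phi> p \<noteq> 0}"] b by auto
  obtain w2 where w2: "loc_integrable w2" "\<And>v. v \<in> snd ` {p. \<phi> p \<noteq> 0} \<Longrightarrow> w2 v = frac_kernel a v"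
    using frac_kernel_weight[of a "snd ` {p. \<phi> p \<noteq> 0}"] a by auto
  have weights: "w1 u * (w2 v * \<phi> (u, v)) = frac_kernel b u * (frac_kernel a v * \<phi> (u, v))" for u v
  proof (cases "\<phi> (u, v) = 0")
    case False
    then show ?thesis
      using w1(2)[of u] w2(2)[of v] by force
  qed simp
  have int: "integrable (lborel \<Otimes>\<^sub>M lborel) (\<lambda>(u, v). frac_kernel b u * (frac_kernel a v * \<phi> (u, v)))"
    using integrable_loc_integrable_prod[OF w1(1) w2(1) \<phi>] by (simp only: weights)
  then show ?thesis
    using lborel_pair.integral_fst'[OF int] by (simp add: has_bochner_integral_iff lborel_prod eq)
qed

lemma has_bochner_integral_fundamental_solution:
  fixes \<phi> :: "real \<times> real \<Rightarrow> complex"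
  assumes "test_function \<phi>"
    and "Re \<beta> > 0 \<or> (\<exists>\<epsilon>>0. \<forall>p. \<phi> p \<noteq> 0 \<longrightarrow> \<epsilon> \<le> \<bar>fst p\<bar>)"
    and "Re \<alpha> > 0 \<or> (\<exists>\<epsilon>>0. \<forall>p. \<phi> p \<noteq> 0 \<longrightarrow> \<epsilon> \<le> \<bar>snd p\<bar>)"
  shows "has_bochner_integral lborel
    (\<lambda>(u, v). of_real u powr (\<beta> - 1) * of_real v powr (\<alpha> - 1) / (2 * Gamma \<beta> * Gamma \<alpha>)
      * heaviside u * heaviside v * \<phi> (u, v))
    (1 / 2 * tensor (frac_delta (- \<beta>)) (frac_delta (- \<alpha>)) \<phi>)"
proof -
  have "(\<lambda>(u, v). of_real u powr (\<beta> - 1) * of_real v powr (\<alpha> - 1) / (2 * Gamma \<beta> * Gamma \<alpha>)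
      * heaviside u * heaviside v * \<phi> (u, v))
    = (\<lambda>p. 1 / 2 * (case p of (u, v) \<Rightarrow> frac_kernel \<beta> u * (frac_kernel \<alpha> v * \<phi> (u, v))))"
    by (auto simp: frac_kernel_def fun_eq_iff)
  then show ?thesis
    using has_bochner_integral_mult_right[OF has_bochner_integral_tensor_frac_delta[OF assms], of "1 / 2"]
    by simp
qed

section \<open>Light-cone coordinates\<close>

text \<open>The map (x, t) to (x + t, x - t) has determinant - 2. It is split into one-dimensional
  substitutions: y = x + t for fixed t, then w = y - 2 * t for fixed y.\<close>

lemma nn_integral_light_cone:
  assumes [measurable]: "g \<in> borel_measurable (borel :: (real \<times> real) measure)"
  shows "2 * (\<integral>\<^sup>+p. g (fst p + snd p, fst p - snd p) \<partial>lborel) = (\<integral>\<^sup>+p. g p \<partial>lborel)"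
proof -
  have m [measurable]: "(\<lambda>p. h (fst p) (snd p)) \<in> borel_measurable (lborel \<Otimes>\<^sub>M lborel)"
    if "continuous_on UNIV (\<lambda>p. h (fst p) (snd p))" for h :: "real \<Rightarrow> real \<Rightarrow> real \<times> real"
    using borel_measurable_continuous_onI[OF that] by (simp add: lborel_prod)
  have "(\<lambda>p. g (fst p + snd p, fst p - snd p)) \<in> borel_measurable (lborel \<Otimes>\<^sub>M lborel)"
    by (intro measurable_compose[OF m assms] continuous_intros)
  then have "(\<integral>\<^sup>+p. g (fst p + snd p, fst p - snd p) \<partial>lborel)
      = (\<integral>\<^sup>+t. \<integral>\<^sup>+x. g (x + t, x - t) \<partial>lborel \<partial>lborel)"
    using lborel_pair.nn_integral_snd[of "\<lambda>p. g (fst p + snd p, fst p - snd p)"] by (simp add: lborel_prod)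
  also have "\<dots> = (\<integral>\<^sup>+t. \<integral>\<^sup>+y. g (y, y - 2 * t) \<partial>lborel \<partial>lborel)"
  proof (rule nn_integral_cong)
    fix t :: real
    show "(\<integral>\<^sup>+x. g (x + t, x - t) \<partial>lborel) = (\<integral>\<^sup>+y. g (y, y - 2 * t) \<partial>lborel)"
      using nn_integral_real_affine[of "\<lambda>y. g (y, y - 2 * t)" 1 t] by (simp add: algebra_simps)
  qed
  also have "\<dots> = (\<integral>\<^sup>+y. \<integral>\<^sup>+t. g (y, y - 2 * t) \<partial>lborel \<partial>lborel)"
    by (rule lborel_pair.Fubini'[symmetric]) measurable
  finally have "2 * (\<integral>\<^sup>+p. g (fst p + snd p, fst p - snd p) \<partial>lborel)
      = (\<integral>\<^sup>+y. 2 * (\<integral>\<^sup>+t. g (y, y - 2 * t) \<partial>lborel) \<partial>lborel)"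
    by (simp add: nn_integral_cmult)
  also have "\<dots> = (\<integral>\<^sup>+y. \<integral>\<^sup>+w. g (y, w) \<partial>lborel \<partial>lborel)"
  proof (rule nn_integral_cong)
    fix y :: real
    show "2 * (\<integral>\<^sup>+t. g (y, y - 2 * t) \<partial>lborel) = (\<integral>\<^sup>+w. g (y, w) \<partial>lborel)"
      using nn_integral_real_affine[of "\<lambda>w. g (y, w)" "- 2" y] by simp
  qed
  also have "\<dots> = (\<integral>\<^sup>+p. g p \<partial>lborel)"
    using lborel.nn_integral_fst[of g lborel] by (simp add: lborel_prod)
  finally show ?thesis .
qed

text \<open>On indicators the nonnegative case says that Lebesgue measure is twice its image under
  \<open>T\<close>; the rules for densities and image measures then transfer the Bochner
  integral.\<close>

lemma has_bochner_integral_light_cone: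
  fixes f :: "real \<times> real \<Rightarrow> complex"
  assumes f: "has_bochner_integral lborel f I"
  shows "has_bochner_integral lborel (\<lambda>(x, t). f (x + t, x - t)) (1 / 2 * I)"
proof -
  define T where "T p = (fst p + snd p, fst p - snd p)" for p :: "real \<times> real"
  have T [measurable]: "T \<in> borel_measurable borel"
    unfolding T_def[abs_def] by (intro borel_measurable_continuous_onI continuous_intros)
  have fm [measurable]: "f \<in> borel_measurable borel"
    using f by (auto dest: borel_measurable_has_bochner_integral)
  have eq: "lborel = density (distr lborel borel T) (\<lambda>_. 2)"
  proof (rule measure_eqI)
    fix A :: "(real \<times> real) set" assume "A \<in> sets lborel"
    then have [measurable]: "A \<in> sets borel"
      by simp
    have "emeasure (density (distr lborel borel T) (\<lambda>_. 2)) A = 2 * (\<integral>\<^sup>+p. indicator A (T p) \<partial>lborel)"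
      using nn_integral_distr[of T lborel borel "indicator A"] by (simp add: emeasure_density_const)
    also have "\<dots> = emeasure lborel A"
      using nn_integral_light_cone[of "indicator A"] by (simp add: T_def)
    finally show "emeasure lborel A = emeasure (density (distr lborel borel T) (\<lambda>_. 2)) A"
      by simp
  qed simp
  have "integrable (density (distr lborel borel T) (\<lambda>_. ennreal 2)) f"
    "integral\<^sup>L (density (distr lborel borel T) (\<lambda>_. ennreal 2)) f = I"
    using f eq by (simp_all add: has_bochner_integral_iff)
  then have "integrable lborel (\<lambda>p. 2 * f (T p))" "2 * (LINT p|lborel. f (T p)) = I"
    using integrable_density[of f "distr lborel borel T" "\<lambda>_. 2"] integral_density[of f "distr lborel borel T" "\<lambda>_. 2"]
    by (simp_all add: integrable_distr_eq integral_distr scaleR_conv_of_real)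
  then have "has_bochner_integral lborel (\<lambda>p. f (T p)) (1 / 2 * I)"
    using integrable_mult_right[of "1 / 2 :: complex" lborel "\<lambda>p. 2 * f (T p)"]
    by (auto simp: has_bochner_integral_iff)
  then show ?thesis
    by (simp add: T_def case_prod_unfold)
qed

text \<open>A continuous function without zeros on a compact set is bounded away from 0 there.
  \<open>P\<close> stands for the alternative that the kernel in question is locally
  integrable.\<close>

lemma tsupport_away:
  assumes \<phi>: "test_function \<phi>" and l: "continuous_on UNIV l"
    and nz: "P \<or> (\<forall>p\<in>tsupport \<phi>. l p \<noteq> 0)"
  shows "P \<or> (\<exists>\<epsilon>>0. \<forall>p. \<phi> p \<noteq> 0 \<longrightarrow> \<epsilon> \<le> \<bar>l p :: real\<bar>)"
  using nz
proof
  assume nz: "\<forall>p\<in>tsupport \<phi>. l p \<noteq> 0"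
  have "compact (l ` tsupport \<phi>)"
    using \<phi> l continuous_on_subset by (intro compact_continuous_image) (auto simp: test_function_def)
  then have "closed (l ` tsupport \<phi>)"
    by (rule compact_imp_closed)
  then obtain d where d: "d > 0" "\<forall>x\<in>l ` tsupport \<phi>. d \<le> dist 0 x"
    using separate_point_closed[of "l ` tsupport \<phi>" 0] nz by force
  have "p \<in> tsupport \<phi>" if "\<phi> p \<noteq> 0" for p
    using that closure_subset[of "{p. \<phi> p \<noteq> 0}"] by (auto simp: tsupport_def)
  then show ?thesis
    using d by auto
qed simp

lemma test_function_light_cone:
  fixes \<psi> :: "real \<times> real \<Rightarrow> complex"
  assumes \<psi>: "test_function \<psi>"
  shows "test_function (\<lambda>(u, v). \<psi> ((u + v) / 2, (u - v) / 2))"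
proof -
  define l where "l p = ((fst p + snd p) / 2, (fst p - snd p) / 2)" for p :: "real \<times> real"
  have l: "linear l"
    by (rule linearI) (auto simp: l_def algebra_simps add_divide_distrib diff_divide_distrib)
  have "smooth (\<lambda>p. \<psi> (0 + l p))"
    by (rule smooth_affine[OF l test_function_smooth[OF \<psi>]])
  moreover obtain R where R: "\<And>x. norm x > R \<Longrightarrow> \<psi> x = 0"
    using test_functionE[OF \<psi>] by metis
  \<comment> \<open>If both coordinates of \<open>l p\<close> are at most R in modulus, then u and
    v, their sum and difference, are at most 2 * R, and the norm of (u, v) at most 4 * R.\<close>
  have "\<psi> (l p) = 0" if "norm p > 4 * R" for p
  proof (rule R, rule ccontr)
    assume "\<not> norm (l p) > R"
    then have "\<bar>fst p + snd p\<bar> / 2 \<le> R" "\<bar>fst p - snd p\<bar> / 2 \<le> R"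
      using norm_fst_le[of "fst (l p)" "snd (l p)"] norm_snd_le[of "snd (l p)" "fst (l p)"]
      by (auto simp: l_def)
    then have "\<bar>fst p\<bar> \<le> 2 * R" "\<bar>snd p\<bar> \<le> 2 * R"
      by (auto simp: abs_le_iff)
    then show False
      using that norm_Pair_le[of "fst p" "snd p"] by simp
  qed
  moreover have "(\<lambda>(u, v). \<psi> ((u + v) / 2, (u - v) / 2)) = (\<lambda>p. \<psi> (l p))"
    by (simp add: l_def case_prod_unfold)
  ultimately show ?thesis
    by (auto simp: test_function_iff)
qed

text \<open>\<open>E\<close> is defined for all complex orders, whereas the function x^(a - 1) may
  fail to be integrable near 0 when Re a \<le> 0. The pointwise formulas are then tested on
  functions supported away from the line where the factor is singular.\<close>

theorem mainTheorem4:
  fixes \<alpha> \<beta> :: complex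
    and E :: "(real \<times> real \<Rightarrow> complex) \<Rightarrow> complex"
  assumes E: "E = (\<lambda>\<phi>. 1 / 2 * tensor (frac_delta (- \<beta>)) (frac_delta (- \<alpha>)) \<phi>)"
  shows "(\<forall>f. distribution f \<longrightarrow> (wave_equation \<alpha> \<beta> f \<longleftrightarrow> wave_integral_equation \<alpha> \<beta> f)) \<and>
         fundamental_solution \<alpha> \<beta> E \<and>
         (\<forall>\<phi>. test_function \<phi> \<longrightarrow>
           (Re \<beta> > 0 \<or> (\<forall>(u, v) \<in> tsupport \<phi>. u \<noteq> 0)) \<longrightarrow>
           (Re \<alpha> > 0 \<or> (\<forall>(u, v) \<in> tsupport \<phi>. v \<noteq> 0)) \<longrightarrow>
           has_bochner_integral lborel
             (\<lambda>(u, v). of_real u powr (\<beta> - 1) * of_real v powr (\<alpha> - 1) / (2 * Gamma \<beta> * Gamma \<alpha>)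
                * heaviside u * heaviside v * \<phi> (u, v))
             (E \<phi>)) \<and>
         (\<forall>\<psi>. test_function \<psi> \<longrightarrow>
           (Re \<beta> > 0 \<or> (\<forall>(x, t) \<in> tsupport \<psi>. x + t \<noteq> 0)) \<longrightarrow>
           (Re \<alpha> > 0 \<or> (\<forall>(x, t) \<in> tsupport \<psi>. x - t \<noteq> 0)) \<longrightarrow>
           has_bochner_integral lborel
             (\<lambda>(x, t). of_real (x + t) powr (\<beta> - 1) * of_real (x - t) powr (\<alpha> - 1)
                / (2 * Gamma \<beta> * Gamma \<alpha>) * heaviside (x + t) * heaviside (x - t) * \<psi> (x, t))
             (in_xt E \<psi>))"
proof (intro conjI allI impI)
  fix f :: "(real \<times> real \<Rightarrow> complex) \<Rightarrow> complex"
  show "wave_equation \<alpha> \<beta> f \<longleftrightarrow> wave_integral_equation \<alpha> \<beta> f"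
    by (simp add: wave_equation_def wave_operator_def wave_integral_equation_def
        has_frac_deriv_iff_has_convolution u_dir_Basis v_dir_Basis)
next
  \<comment> \<open>The intermediate distribution is \<delta>^(-\<beta>)(u) \<delta>(v) / 2.\<close>
  have "has_frac_deriv v_dir \<alpha> E (\<lambda>\<phi>. 1 / 2 * tensor (frac_delta (- \<beta>)) dirac \<phi>)"
    unfolding E by (rule has_frac_deriv_v_dir_tensor)
  moreover have "distribution E"
    unfolding E by (intro distribution_scale distribution_tensor_frac_delta)
  ultimately show "fundamental_solution \<alpha> \<beta> E"
    unfolding fundamental_solution_def wave_operator_def using has_frac_deriv_u_dir_tensor by blast
next
  fix \<phi> :: "real \<times> real \<Rightarrow> complex"
  assume \<phi>: "test_function \<phi>"
    and b: "Re \<beta> > 0 \<or> (\<forall>(u, v) \<in> tsupport \<phi>. u \<noteq> 0)"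
    and a: "Re \<alpha> > 0 \<or> (\<forall>(u, v) \<in> tsupport \<phi>. v \<noteq> 0)"
  have "Re \<beta> > 0 \<or> (\<exists>\<epsilon>>0. \<forall>p. \<phi> p \<noteq> 0 \<longrightarrow> \<epsilon> \<le> \<bar>fst p\<bar>)"
    using b by (intro tsupport_away[OF \<phi>] continuous_intros) (simp add: case_prod_beta)
  moreover have "Re \<alpha> > 0 \<or> (\<exists>\<epsilon>>0. \<forall>p. \<phi> p \<noteq> 0 \<longrightarrow> \<epsilon> \<le> \<bar>snd p\<bar>)"
    using a by (intro tsupport_away[OF \<phi>] continuous_intros) (simp add: case_prod_beta)
  ultimately
  show "has_bochner_integral lborel
      (\<lambda>(u, v). of_real u powr (\<beta> - 1) * of_real v powr (\<alpha> - 1) / (2 * Gamma \<beta> * Gamma \<alpha>)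
        * heaviside u * heaviside v * \<phi> (u, v)) (E \<phi>)"
    unfolding E by (rule has_bochner_integral_fundamental_solution[OF \<phi>])
next
  fix \<psi> :: "real \<times> real \<Rightarrow> complex"
  let ?\<phi> = "\<lambda>(u, v). \<psi> ((u + v) / 2, (u - v) / 2)"
  assume \<psi>: "test_function \<psi>"
    and b: "Re \<beta> > 0 \<or> (\<forall>(x, t) \<in> tsupport \<psi>. x + t \<noteq> 0)"
    and a: "Re \<alpha> > 0 \<or> (\<forall>(x, t) \<in> tsupport \<psi>. x - t \<noteq> 0)"
  have "Re \<beta> > 0 \<or> (\<exists>\<epsilon>>0. \<forall>p. \<psi> p \<noteq> 0 \<longrightarrow> \<epsilon> \<le> \<bar>fst p + snd p\<bar>)"
    using b by (intro tsupport_away[OF \<psi>] continuous_intros) (simp add: case_prod_beta)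
  \<comment> \<open>At the point ((u + v) / 2, (u - v) / 2) the form x + t equals u, and x - t
    equals v.\<close>
  then have b': "Re \<beta> > 0 \<or> (\<exists>\<epsilon>>0. \<forall>p. ?\<phi> p \<noteq> 0 \<longrightarrow> \<epsilon> \<le> \<bar>fst p\<bar>)"
    by (force simp: field_simps)
  have "Re \<alpha> > 0 \<or> (\<exists>\<epsilon>>0. \<forall>p. \<psi> p \<noteq> 0 \<longrightarrow> \<epsilon> \<le> \<bar>fst p - snd p\<bar>)"
    using a by (intro tsupport_away[OF \<psi>] continuous_intros) (simp add: case_prod_beta)
  then have a': "Re \<alpha> > 0 \<or> (\<exists>\<epsilon>>0. \<forall>p. ?\<phi> p \<noteq> 0 \<longrightarrow> \<epsilon> \<le> \<bar>snd p\<bar>)"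
    by (force simp: field_simps)
  \<comment> \<open>The factor 1 / 2 from the change of variables is the one in
    \<open>in_xt\<close>.\<close>
  from has_bochner_integral_light_cone[OF has_bochner_integral_fundamental_solution[OF test_function_light_cone[OF \<psi>] b' a']]
  show "has_bochner_integral lborel
      (\<lambda>(x, t). of_real (x + t) powr (\<beta> - 1) * of_real (x - t) powr (\<alpha> - 1) / (2 * Gamma \<beta> * Gamma \<alpha>)
        * heaviside (x + t) * heaviside (x - t) * \<psi> (x, t)) (in_xt E \<psi>)"
    by (simp add: E in_xt_def)
qed

end
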